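(* For every probability measure $\nu \in \mathcal{M}_{\mathcal{B}}$, the process $\left(\frac{S_n}{\sqrt{n}}\right)_n$ converges in law to $\mathcal{N}(0,\sigma^2)$ under the probability $\tilde{\mathbb{P}} \otimes \nu$.
   Context: Random system. $(\Omega,\mathcal{T},\mathbb{P})$ and $(X,\mathcal{A},m)$ are probability spaces; to each $\omega\in\Omega$ is associated a map $T_\omega:X\to X$, with $(\omega,x)\mapsto T_\omega(x)$ measurable and each $T_\omega$ non-singular with respect to $m$ (i.e. $m(A)=0$ implies $m(T_\omega^{-1}A)=0$). Set $\tilde\Omega=\Omega^{\mathbb{N}}$, with elements $\underline\omega=(\omega_1,\omega_2,\ldots)$, and $\tilde{\mathbb{P}}=\mathbb{P}^{\otimes\mathbb{N}}$. The transfer operator $P_\omega$ of $T_\omega$ acts on $L^1(m)$ and is characterized by $\int_X P_\omega f\, g\,dm=\int_X f\,(g\circ T_\omega)\,dm$ for $f\in L^1(m)$, $g\in L^\infty(m)$. The annealed operators are $Pf(x)=\int_\Omega P_\omega f(x)\,d\mathbb{P}(\omega)$ on $L^1(m)$ and $Ug(x)=\int_\Omega g(T_\omega x)\,d\mathbb{P}(\omega)$ on $L^\infty(m)$. A probability measure $\mu$ on $X$ is stationary if $\mu(A)=\int_\Omega\mu(T_\omega^{-1}A)\,d\mathbb{P}(\omega)$ for all $A\in\mathcal{A}$. Standing assumptions. There is a Banach space $(\mathcal{B},\|\cdot\|)$ of complex-valued functions such that: (1) $\mathcal{B}$ is compactly embedded in $L^1(m)$; (2) constant functions lie in $\mathcal{B}$;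 (3) $\mathcal{B}$ is a complex Banach lattice: $|f|,\bar f\in\mathcal{B}$ for all $f\in\mathcal{B}$; (4) $P(\mathcal{B})\subset\mathcal{B}$ and $P$ acts continuously on $\mathcal{B}$; (5) there are $N\ge1$, $\rho<1$, $K\ge0$ with $\|P^Nf\|\le\rho\|f\|+K\|f\|_{L^1(m)}$ for all $f\in\mathcal{B}$; (6) $1$ is a simple isolated eigenvalue of $P$ on $\mathcal{B}$ and there is no other eigenvalue on the unit circle. Then there is a unique stationary probability measure absolutely continuous with respect to $m$, denoted $\mu$, with density $h\in\mathcal{B}$, $Ph=h$. There is also a Banach space $\mathcal{B}_0\subset L^1(m)$ with norm $\|\cdot\|_0$ and a constant $C>0$ with $\|fg\|\le C\|f\|_0\|g\|$ for all $f\in\mathcal{B}_0$, $g\in\mathcal{B}$. Observable. $\varphi\in\mathcal{B}_0$ is a bounded real function with $\int_X\varphi\,d\mu=0$; $X_k(\underline\omega,x)=\varphi(T_{\omega_k}\cdots T_{\omega_1}x)$ (with $X_0=\varphi(x)$), $S_n=\sum_{k=0}^{n-1}X_k$, and $\sigma^2=\lim_{n\to\infty}\frac1n\mathbb{E}_{\tilde{\mathbb{P}}\otimes\mu}(S_n^2)=\int_X\varphi^2\,d\mu+2\sum_{n=1}^\infty\int_X\varphi\,U^n\varphi\,d\mu$ (the limit exists under these assumptions). $\mathcal{M}_{\mathcal{B}}$ is the set of probability measures on $(X,\mathcal{A})$ that are absolutely continuous with respect to $m$ with density in $\mathcal{B}$. $\mathcal{N}(0,0)$ is the Dirac mass at $0$.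 *)

theory Defs
  imports "HOL-Probability.Probability"
begin

section \<open>Function spaces over a measure space\<close>

text \<open>
  Elements of \<open>L\<^sup>1(m)\<close>, and of the Banach spaces contained in it, are classes of functions modulo
  \<open>m\<close>-almost everywhere equality.  Throughout, such a space is represented by the set of all
  representatives of its elements, and equality in the space is almost everywhere equality.
\<close>

definition L1 :: "'x measure \<Rightarrow> ('x \<Rightarrow> complex) set" where
  "L1 m = {f. integrable m f}"

definition L1_norm :: "'x measure \<Rightarrow> ('x \<Rightarrow> complex) \<Rightarrow> real" where
  "L1_norm m f = (LINT x|m. cmod (f x))"

definition Linf :: "'x measure \<Rightarrow> ('x \<Rightarrow> complex) set" where
  "Linf m = {g \<in> borel_measurable m. \<exists>c. AE x in m. cmod (g x) \<le> c}"

text \<open>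
  A complex Banach space contained in \<open>L\<^sup>1(m)\<close>.  On representatives the norm is only a seminorm, whose
  kernel is exactly the set of functions vanishing almost everywhere.
\<close>

locale banach_function_space =
  fixes m :: "'x measure" and B :: "('x \<Rightarrow> complex) set" and nrm :: "('x \<Rightarrow> complex) \<Rightarrow> real"
  assumes subset_L1: "B \<subseteq> L1 m"
    and AE_closed: "\<And>f g. f \<in> B \<Longrightarrow> g \<in> borel_measurable m \<Longrightarrow> AE x in m. g x = f x \<Longrightarrow> g \<in> B"
    and zero_mem: "(\<lambda>_. 0) \<in> B"
    and add_mem: "\<And>f g. f \<in> B \<Longrightarrow> g \<in> B \<Longrightarrow> (\<lambda>x. f x + g x) \<in> B"
    and scale_mem: "\<And>c f. f \<in> B \<Longrightarrow> (\<lambda>x. c * f x) \<in> B"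
    and nrm_nonneg: "\<And>f. f \<in> B \<Longrightarrow> 0 \<le> nrm f"
    and nrm_eq_0_iff: "\<And>f. f \<in> B \<Longrightarrow> nrm f = 0 \<longleftrightarrow> (AE x in m. f x = 0)"
    and nrm_triangle: "\<And>f g. f \<in> B \<Longrightarrow> g \<in> B \<Longrightarrow> nrm (\<lambda>x. f x + g x) \<le> nrm f + nrm g"
    and nrm_scale: "\<And>c f. f \<in> B \<Longrightarrow> nrm (\<lambda>x. c * f x) = cmod c * nrm f"
    and complete: "\<And>F :: nat \<Rightarrow> 'x \<Rightarrow> complex.
      (\<And>n. F n \<in> B) \<Longrightarrow>
      (\<And>e. e > 0 \<Longrightarrow> \<exists>M. \<forall>i\<ge>M. \<forall>j\<ge>M. nrm (\<lambda>x. F i x - F j x) < e) \<Longrightarrow>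
      \<exists>f\<in>B. (\<lambda>n. nrm (\<lambda>x. F n x - f x)) \<longlonglongrightarrow> 0"

definition compactly_embedded_in_L1 ::
    "'x measure \<Rightarrow> ('x \<Rightarrow> complex) set \<Rightarrow> (('x \<Rightarrow> complex) \<Rightarrow> real) \<Rightarrow> bool" where
  "compactly_embedded_in_L1 m B nrm \<longleftrightarrow>
     B \<subseteq> L1 m \<and>
     (\<exists>c. \<forall>f\<in>B. L1_norm m f \<le> c * nrm f) \<and>
     (\<forall>F :: nat \<Rightarrow> 'x \<Rightarrow> complex. \<forall>R. (\<forall>n. F n \<in> B \<and> nrm (F n) \<le> R) \<longrightarrow>
        (\<exists>r g. strict_mono r \<and> g \<in> L1 m \<and> (\<lambda>n. L1_norm m (\<lambda>x. F (r n) x - g x)) \<longlonglongrightarrow> 0))"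

section \<open>Spectral notions for an operator on a function space\<close>

definition eigenvector ::
    "'x measure \<Rightarrow> ('x \<Rightarrow> complex) set \<Rightarrow> (('x \<Rightarrow> complex) \<Rightarrow> ('x \<Rightarrow> complex)) \<Rightarrow> complex
      \<Rightarrow> ('x \<Rightarrow> complex) \<Rightarrow> bool" where
  "eigenvector m B P l f \<longleftrightarrow>
     f \<in> B \<and> \<not> (AE x in m. f x = 0) \<and> (AE x in m. P f x = l * f x)"

definition eigenvalue ::
    "'x measure \<Rightarrow> ('x \<Rightarrow> complex) set \<Rightarrow> (('x \<Rightarrow> complex) \<Rightarrow> ('x \<Rightarrow> complex)) \<Rightarrow> complex \<Rightarrow> bool" where
  "eigenvalue m B P l \<longleftrightarrow> (\<exists>f. eigenvector m B P l f)"

text \<open>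
  Simplicity is required of the eigenspace only.  For the eigenvalue \<open>1\<close> of an annealed transfer
  operator this is no different from algebraic simplicity: \<open>P f = f + h\<close> and \<open>P h = h\<close> give
  \<open>P\<^sup>n f = f + n h\<close>, and \<open>P\<close> is a contraction of \<open>L\<^sup>1(m)\<close>, so \<open>h = 0\<close>.
\<close>

definition simple_eigenvalue ::
    "'x measure \<Rightarrow> ('x \<Rightarrow> complex) set \<Rightarrow> (('x \<Rightarrow> complex) \<Rightarrow> ('x \<Rightarrow> complex)) \<Rightarrow> complex \<Rightarrow> bool" where
  "simple_eigenvalue m B P l \<longleftrightarrow>
     (\<exists>f. eigenvector m B P l f \<and>
        (\<forall>g. eigenvector m B P l g \<longrightarrow> (\<exists>c. AE x in m. g x = c * f x)))"

text \<open>
  The resolvent set: \<open>l - P\<close> is onto \<open>B\<close> and bounded below, i.e. a bijection with bounded inverse.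
\<close>

definition in_resolvent_set ::
    "'x measure \<Rightarrow> ('x \<Rightarrow> complex) set \<Rightarrow> (('x \<Rightarrow> complex) \<Rightarrow> real)
      \<Rightarrow> (('x \<Rightarrow> complex) \<Rightarrow> ('x \<Rightarrow> complex)) \<Rightarrow> complex \<Rightarrow> bool" where
  "in_resolvent_set m B nrm P l \<longleftrightarrow>
     (\<forall>g\<in>B. \<exists>f\<in>B. AE x in m. l * f x - P f x = g x) \<and>
     (\<exists>c. \<forall>f\<in>B. nrm f \<le> c * nrm (\<lambda>x. l * f x - P f x))"

definition isolated_in_spectrum ::
    "'x measure \<Rightarrow> ('x \<Rightarrow> complex) set \<Rightarrow> (('x \<Rightarrow> complex) \<Rightarrow> real)
      \<Rightarrow> (('x \<Rightarrow> complex) \<Rightarrow> ('x \<Rightarrow> complex)) \<Rightarrow> complex \<Rightarrow> bool" where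
  "isolated_in_spectrum m B nrm P l \<longleftrightarrow>
     (\<exists>e>0. \<forall>z. 0 < cmod (z - l) \<and> cmod (z - l) < e \<longrightarrow> in_resolvent_set m B nrm P z)"

section \<open>Random systems and their transfer operators\<close>

locale random_system = Omega: prob_space W + X: prob_space m
  for W :: "'w measure" and m :: "'x measure" +
  fixes T :: "'w \<Rightarrow> 'x \<Rightarrow> 'x"
  assumes measurable_T: "(\<lambda>(w, x). T w x) \<in> W \<Otimes>\<^sub>M m \<rightarrow>\<^sub>M m"
    and nonsingular: "\<And>w A. w \<in> space W \<Longrightarrow> A \<in> null_sets m \<Longrightarrow> T w -` A \<inter> space m \<in> null_sets m"

definition is_transfer ::
    "'x measure \<Rightarrow> ('x \<Rightarrow> 'x) \<Rightarrow> ('x \<Rightarrow> complex) \<Rightarrow> ('x \<Rightarrow> complex) \<Rightarrow> bool" where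
  "is_transfer m t f p \<longleftrightarrow>
     p \<in> L1 m \<and> (\<forall>g\<in>Linf m. (LINT x|m. p x * g x) = (LINT x|m. f x * g (t x)))"

text \<open>
  The formula \<open>P f (x) = \<integral> P\<^sub>w f (x) dW(w)\<close> involves values at points of the classes \<open>P\<^sub>w f\<close>, hence
  a choice of representatives \<open>p w\<close> of \<open>P\<^sub>w f\<close> that makes the integrand jointly measurable.
  By Fubini's theorem the class of \<open>P f\<close> does not depend on this choice.
\<close>

definition annealed_transfer_operator ::
    "'w measure \<Rightarrow> 'x measure \<Rightarrow> ('w \<Rightarrow> 'x \<Rightarrow> 'x) \<Rightarrow> (('x \<Rightarrow> complex) \<Rightarrow> ('x \<Rightarrow> complex)) \<Rightarrow> bool" where
  "annealed_transfer_operator W m T P \<longleftrightarrow>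
     (\<forall>f\<in>L1 m. P f \<in> L1 m \<and>
        (\<exists>p. (\<lambda>(w, x). p w x) \<in> borel_measurable (W \<Otimes>\<^sub>M m) \<and>
             (AE w in W. is_transfer m (T w) f (p w)) \<and>
             (AE x in m. P f x = (LINT w|W. p w x))))"

definition stationary :: "'w measure \<Rightarrow> ('w \<Rightarrow> 'x \<Rightarrow> 'x) \<Rightarrow> 'x measure \<Rightarrow> bool" where
  "stationary W T \<mu> \<longleftrightarrow>
     (\<forall>A\<in>sets \<mu>. emeasure \<mu> A = (\<integral>\<^sup>+ w. emeasure \<mu> (T w -` A \<inter> space \<mu>) \<partial>W))"

text \<open>The set \<open>\<M>\<^sub>B\<close>; absolute continuity is implied by the form of the measure.\<close>

definition prob_measures_with_density_in ::
    "'x measure \<Rightarrow> ('x \<Rightarrow> complex) set \<Rightarrow> 'x measure set" where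
  "prob_measures_with_density_in m B =
     {\<nu>. prob_space \<nu> \<and>
         (\<exists>h :: 'x \<Rightarrow> real. h \<in> borel_measurable m \<and> (\<forall>x\<in>space m. 0 \<le> h x) \<and>
            (\<lambda>x. complex_of_real (h x)) \<in> B \<and> \<nu> = density m (\<lambda>x. ennreal (h x)))}"

section \<open>Birkhoff sums along random orbits\<close>

text \<open>Sequences are indexed from \<open>0\<close>: the first map applied is \<open>T (w 0)\<close>.\<close>

primrec random_orbit :: "('w \<Rightarrow> 'x \<Rightarrow> 'x) \<Rightarrow> (nat \<Rightarrow> 'w) \<Rightarrow> nat \<Rightarrow> 'x \<Rightarrow> 'x" where
  "random_orbit T w 0 x = x"
| "random_orbit T w (Suc k) x = T (w k) (random_orbit T w k x)"

definition birkhoff_sum ::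
    "('w \<Rightarrow> 'x \<Rightarrow> 'x) \<Rightarrow> ('x \<Rightarrow> real) \<Rightarrow> nat \<Rightarrow> (nat \<Rightarrow> 'w) \<times> 'x \<Rightarrow> real" where
  "birkhoff_sum T \<phi> n = (\<lambda>(w, x). \<Sum>k<n. \<phi> (random_orbit T w k x))"

definition annealed_measure ::
    "'w measure \<Rightarrow> 'x measure \<Rightarrow> ((nat \<Rightarrow> 'w) \<times> 'x) measure" where
  "annealed_measure W \<nu> = (\<Pi>\<^sub>M k\<in>UNIV. W) \<Otimes>\<^sub>M \<nu>"

definition asymptotic_variance ::
    "'w measure \<Rightarrow> ('w \<Rightarrow> 'x \<Rightarrow> 'x) \<Rightarrow> 'x measure \<Rightarrow> ('x \<Rightarrow> real) \<Rightarrow> real" where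
  "asymptotic_variance W T \<mu> \<phi> =
     lim (\<lambda>n. (1 / real n) * (LINT z|annealed_measure W \<mu>. (birkhoff_sum T \<phi> n z)\<^sup>2))"

text \<open>The law \<open>\<N>(a, v)\<close>, parametrised by the variance; \<open>\<N>(a, 0)\<close> is the Dirac mass at \<open>a\<close>.\<close>

definition normal_law :: "real \<Rightarrow> real \<Rightarrow> real measure" where
  "normal_law a v =
     (if v = 0 then return borel a
      else density lborel (\<lambda>x. ennreal (normal_density a (sqrt v) x)))"

end

theory Submission
  imports Defs
begin

text \<open>
  The characteristic function of \<open>S\<^sub>n\<close> under an initial density \<open>f\<close> is \<open>\<integral> P\<^sub>t\<^sup>n f dm\<close>, where
  \<open>P\<^sub>t f = P (exp (\<i>t\<phi>) f)\<close>.  This follows from the Markov property, lemma \<open>pairing_shift\<close>, since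
  \<open>S\<^sub>n\<^sub>+\<^sub>1\<close> is \<open>\<phi>\<close> plus \<open>S\<^sub>n\<close> along the shifted orbit.  The usual next step is analytic
  perturbation theory for the leading eigenvalue of \<open>P\<^sub>t\<close>.  An approximate eigenvector is enough,
  however, because only times \<open>n\<close> with \<open>n t\<^sup>2\<close> bounded matter and \<open>P\<^sub>t\<close> is a contraction of
  \<open>L\<^sup>1(m)\<close>: if \<open>P\<^sub>t u\<^sub>t = (1 - \<sigma>\<^sup>2 t\<^sup>2 / 2) u\<^sub>t + O(t\<^sup>3)\<close> in \<open>L\<^sup>1\<close> and \<open>u\<^sub>t = h + O(t)\<close>, then at
  \<open>t = \<theta> / sqrt n\<close> the accumulated error is \<open>n O(t\<^sup>3) = O(1 / sqrt n)\<close> and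
  \<open>\<integral> P\<^sub>t\<^sup>n h dm\<close> tends to \<open>exp (- \<sigma>\<^sup>2 \<theta>\<^sup>2 / 2)\<close>.

  Such a \<open>u\<^sub>t = h + \<i>t v + (\<i>t)\<^sup>2 v2\<close> is found by comparing coefficients:
  \<open>(1 - P) v = P (\<phi> h)\<close> and \<open>(1 - P) v2 = P (\<phi> v + \<phi>\<^sup>2 h / 2) - (\<sigma>\<^sup>2 / 2) h\<close>.  These are Poisson equations
  whose right-hand sides lie in \<open>B\<close> and have mean zero, the second one because \<open>\<sigma>\<^sup>2\<close> is
  \<open>\<integral> \<phi>\<^sup>2 h dm + 2 \<integral> \<phi> v dm\<close>.  That \<open>1 - P\<close> maps the mean-zero part of \<open>B\<close> onto itself is theorem
  \<open>poisson_equation_solvable\<close>: compactness, the Lasota--Yorke inequality and simplicity of the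
  eigenvalue \<open>1\<close> bound \<open>1 - P\<close> from below there (\<open>defect_bounded_below\<close>), and since the eigenvalue is
  isolated, solutions of \<open>(z - P) f = g\<close> exist for \<open>z\<close> near \<open>1\<close> and converge as \<open>z \<rightarrow> 1\<close>.

  Poisson equations settle the two remaining points as well.  The second moment of \<open>S\<^sub>n\<close> telescopes
  to \<open>n \<sigma>\<^sup>2\<close> up to a bounded term, which identifies \<open>\<sigma>\<^sup>2\<close> with the asymptotic variance; and the
  density of \<open>\<nu>\<close> is \<open>h + w - P w\<close> for some \<open>w\<close> in \<open>B\<close>, where \<open>w - P w\<close> compares \<open>S\<^sub>n\<close> with
  itself one step later and is therefore negligible.  Levy's continuity theorem concludes.
\<close>

section \<open>Duality for the annealed transfer operator\<close>

lemma AE_zero_if_set_integrals_zero_real: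
  fixes q :: "'a \<Rightarrow> real"
  assumes q: "integrable M q"
    and zero: "\<And>A. A \<in> sets M \<Longrightarrow> (LINT x|M. q x * indicator A x) = 0"
  shows "AE x in M. q x = 0"
proof -
  note [measurable] = borel_measurable_integrable[OF q]
  let ?A = "{x \<in> space M. q x > 0}" and ?B = "{x \<in> space M. q x < 0}"
  have A: "?A \<in> sets M" and B: "?B \<in> sets M" by measurable
  have "AE x in M. q x * indicator ?A x = 0"
    using zero[OF A] integrable_mult_indicator[OF A q]
    by (subst integral_nonneg_eq_0_iff_AE[symmetric])
       (auto simp: indicator_def mult.commute intro!: AE_I2)
  moreover have "AE x in M. - (q x * indicator ?B x) = 0"
    using zero[OF B] integrable_mult_indicator[OF B q]
    by (subst integral_nonneg_eq_0_iff_AE[symmetric])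
       (auto simp: indicator_def mult.commute intro!: AE_I2)
  ultimately show ?thesis
    using AE_space by eventually_elim (auto simp: indicator_def split: if_splits)
qed

lemma AE_zero_if_set_integrals_zero:
  fixes q :: "'a \<Rightarrow> complex"
  assumes q: "integrable M q"
    and zero: "\<And>A. A \<in> sets M \<Longrightarrow> (LINT x|M. q x * indicator A x) = 0"
  shows "AE x in M. q x = 0"
proof -
  have int: "integrable M (\<lambda>x. q x * indicator A x)" if "A \<in> sets M" for A
  proof -
    have "(\<lambda>x. q x * indicator A x) = (\<lambda>x. indicat_real A x *\<^sub>R q x)"
      by (auto simp: indicator_def)
    then show ?thesis using integrable_mult_indicator[OF that q] by simp
  qed
  have "AE x in M. Re (q x) = 0"
  proof (rule AE_zero_if_set_integrals_zero_real)
    fix A assume A: "A \<in> sets M"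
    have "(LINT x|M. Re (q x) * indicator A x) = (LINT x|M. Re (q x * indicator A x))"
      by (intro Bochner_Integration.integral_cong) (auto simp: indicator_def)
    also have "\<dots> = 0" using integral_Re[OF int[OF A]] zero[OF A] by (simp only: zero_complex.sel)
    finally show "(LINT x|M. Re (q x) * indicator A x) = 0" .
  qed (use q in simp)
  moreover have "AE x in M. Im (q x) = 0"
  proof (rule AE_zero_if_set_integrals_zero_real)
    fix A assume A: "A \<in> sets M"
    have "(LINT x|M. Im (q x) * indicator A x) = (LINT x|M. Im (q x * indicator A x))"
      by (intro Bochner_Integration.integral_cong) (auto simp: indicator_def)
    also have "\<dots> = 0" using integral_Im[OF int[OF A]] zero[OF A] by (simp only: zero_complex.sel)
    finally show "(LINT x|M. Im (q x) * indicator A x) = 0" .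
  qed (use q in simp)
  ultimately show ?thesis by eventually_elim (simp add: complex_eq_iff)
qed

text \<open>Test the duality against the conjugate phase of \<open>p\<close>, a function of modulus at most \<open>1\<close>.\<close>

lemma is_transfer_L1_contraction:
  assumes t: "t \<in> measurable m m" and f: "f \<in> L1 m" and p: "is_transfer m t f p"
  shows "(LINT x|m. cmod (p x)) \<le> (LINT x|m. cmod (f x))"
proof -
  have pi: "integrable m p" using p by (simp add: is_transfer_def L1_def)
  have fi: "integrable m f" using f by (simp add: L1_def)
  note [measurable] = borel_measurable_integrable[OF pi] borel_measurable_integrable[OF fi] t
  let ?g = "\<lambda>x. cnj (sgn (p x))"
  have [measurable]: "?g \<in> borel_measurable m"
    unfolding sgn_div_norm
    by (rule measurable_compose[OF _ borel_measurable_continuous_onI[of cnj]])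
       (auto intro!: continuous_intros)
  have g1: "cmod (?g x) \<le> 1" for x by (simp add: norm_sgn)
  have "?g \<in> Linf m" unfolding Linf_def using g1 by (auto intro!: exI[of _ 1])
  then have eq: "(LINT x|m. p x * ?g x) = (LINT x|m. f x * ?g (t x))"
    using p by (simp add: is_transfer_def)
  have pg: "p x * ?g x = of_real (cmod (p x))" for x
    using complex_norm_square[of "p x"]
    by (cases "p x = 0") (auto simp: sgn_div_norm power2_eq_square scaleR_conv_of_real field_simps)
  have "of_real (LINT x|m. cmod (p x)) = (LINT x|m. f x * ?g (t x))"
    by (rule eq[unfolded pg integral_complex_of_real])
  then have "(LINT x|m. cmod (p x)) \<le> cmod (LINT x|m. f x * ?g (t x))"
    by (metis abs_ge_self norm_of_real)
  also have "\<dots> \<le> (LINT x|m. cmod (f x))"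
  proof (rule integral_norm_bound[THEN order_trans], rule integral_mono)
    show "cmod (f x * ?g (t x)) \<le> cmod (f x)" for x
      using g1[of "t x"] by (simp add: norm_mult mult_left_le)
    show i: "integrable m (\<lambda>x. cmod (f x))" using fi by simp
    show "integrable m (\<lambda>x. cmod (f x * ?g (t x)))"
      using g1 by (intro Bochner_Integration.integrable_bound[OF i] integrable_norm)
        (auto simp: norm_mult mult_left_le intro!: AE_I2)
  qed
  finally show ?thesis .
qed

locale annealed_system = random_system W m T
  for W :: "'w measure" and m :: "'x measure" and T :: "'w \<Rightarrow> 'x \<Rightarrow> 'x" +
  fixes P :: "('x \<Rightarrow> complex) \<Rightarrow> ('x \<Rightarrow> complex)"
  assumes annealed: "annealed_transfer_operator W m T P"
begin

sublocale pair: pair_prob_space W m ..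

lemma T_measurable2 [measurable (raw)]:
  "f \<in> measurable M W \<Longrightarrow> g \<in> measurable M m \<Longrightarrow> (\<lambda>z. T (f z) (g z)) \<in> measurable M m"
  using measurable_compose[OF measurable_Pair measurable_T, of f M g] by simp

lemma P_L1: "f \<in> L1 m \<Longrightarrow> P f \<in> L1 m"
  using annealed by (simp add: annealed_transfer_operator_def)

text \<open>
  A jointly measurable choice of the fibre transfers is integrable on the product because each of
  them is an \<open>L\<^sup>1\<close> contraction; this is what makes the exchange of integrals below legitimate.
\<close>

lemma transfer_duality:
  assumes f: "f \<in> L1 m" and g [measurable]: "g \<in> borel_measurable m"
    and bd: "\<And>x. x \<in> space m \<Longrightarrow> cmod (g x) \<le> c"
  shows "(LINT x|m. P f x * g x) = (LINT w|W. LINT x|m. f x * g (T w x))"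
proof -
  obtain p where p [measurable]: "(\<lambda>(w, x). p w x) \<in> borel_measurable (W \<Otimes>\<^sub>M m)"
    and tr: "AE w in W. is_transfer m (T w) f (p w)"
    and Pf: "AE x in m. P f x = (LINT w|W. p w x)"
    using annealed f unfolding annealed_transfer_operator_def by blast
  have fi: "integrable m f" using f by (simp add: L1_def)
  note [measurable] = borel_measurable_integrable[OF fi]
    borel_measurable_integrable[OF P_L1[OF f, unfolded L1_def mem_Collect_eq]]
  have pint: "integrable (W \<Otimes>\<^sub>M m) (\<lambda>(w, x). p w x)"
  proof (rule integrableI_bounded[OF p])
    have "(\<integral>\<^sup>+ z. ennreal (norm (case z of (w, x) \<Rightarrow> p w x)) \<partial>(W \<Otimes>\<^sub>M m))
        = (\<integral>\<^sup>+ w. \<integral>\<^sup>+ x. ennreal (cmod (p w x)) \<partial>m \<partial>W)"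
      by (subst X.nn_integral_fst[symmetric]) simp_all
    also have "\<dots> \<le> (\<integral>\<^sup>+ w. ennreal (LINT x|m. cmod (f x)) \<partial>W)"
    proof (rule nn_integral_mono_AE, use tr AE_space in eventually_elim)
      case (elim w)
      have "integrable m (p w)" using elim by (simp add: is_transfer_def L1_def)
      then have "(\<integral>\<^sup>+ x. ennreal (cmod (p w x)) \<partial>m) = ennreal (LINT x|m. cmod (p w x))"
        by (intro nn_integral_eq_integral) auto
      also have "\<dots> \<le> ennreal (LINT x|m. cmod (f x))"
        using elim by (intro ennreal_leI is_transfer_L1_contraction[OF _ f]) auto
      finally show ?case .
    qed
    also have "\<dots> < \<infinity>" by (simp add: Omega.emeasure_space_1)
    finally show "(\<integral>\<^sup>+ z. ennreal (norm (case z of (w, x) \<Rightarrow> p w x)) \<partial>(W \<Otimes>\<^sub>M m)) < \<infinity>" .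
  qed
  have pgint: "integrable (W \<Otimes>\<^sub>M m) (\<lambda>(w, x). p w x * g x)"
  proof (rule Bochner_Integration.integrable_bound[OF integrable_mult_right[OF integrable_norm[OF pint], of c]])
    show "AE z in W \<Otimes>\<^sub>M m. norm (case z of (w, x) \<Rightarrow> p w x * g x)
        \<le> norm (c * norm (case z of (w, x) \<Rightarrow> p w x))"
    proof (rule AE_I2)
      fix z assume "z \<in> space (W \<Otimes>\<^sub>M m)"
      then obtain w x where z: "z = (w, x)" "x \<in> space m" by (auto simp: space_pair_measure)
      have "cmod (p w x) * cmod (g x) \<le> cmod (p w x) * \<bar>c\<bar>"
        using bd[OF z(2)] by (intro mult_left_mono) auto
      then show "norm (case z of (w, x) \<Rightarrow> p w x * g x) \<le> norm (c * norm (case z of (w, x) \<Rightarrow> p w x))"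
        by (simp add: z norm_mult abs_mult mult.commute)
    qed
  qed measurable
  have "(LINT x|m. P f x * g x) = (LINT x|m. (LINT w|W. p w x) * g x)"
    using Pf by (intro integral_cong_AE) (auto elim!: eventually_mono)
  also have "\<dots> = (LINT x|m. LINT w|W. p w x * g x)" by simp
  also have "\<dots> = (LINT w|W. LINT x|m. p w x * g x)"
    by (rule pair.Fubini_integral[OF pgint])
  also have "\<dots> = (LINT w|W. LINT x|m. f x * g (T w x))"
  proof (rule integral_cong_AE)
    have "g \<in> Linf m" unfolding Linf_def using bd by (auto intro!: exI[of _ c])
    note gL = this
    show "AE w in W. (LINT x|m. p w x * g x) = (LINT x|m. f x * g (T w x))"
      using tr by eventually_elim (simp add: is_transfer_def gL)
  qed measurable
  finally show ?thesis .
qed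

lemma L1_measurable: "f \<in> L1 m \<Longrightarrow> f \<in> borel_measurable m"
  by (auto simp: L1_def)

lemma transfer_set_duality:
  assumes "f \<in> L1 m" "A \<in> sets m"
  shows "(LINT x|m. P f x * indicator A x) = (LINT w|W. LINT x|m. f x * indicator A (T w x))"
  using assms by (intro transfer_duality[where c = 1]) (auto simp: indicator_def)

lemma integrable_indicator_mult:
  fixes f :: "'x \<Rightarrow> complex"
  assumes f: "f \<in> L1 m" and A [measurable]: "A \<in> sets m"
  shows "integrable m (\<lambda>x. f x * indicator A x)"
proof (rule Bochner_Integration.integrable_bound)
  show "integrable m f" using f by (simp add: L1_def)
  show "(\<lambda>x. f x * indicator A x) \<in> borel_measurable m" using L1_measurable[OF f] by measurable
  show "AE x in m. cmod (f x * indicator A x) \<le> cmod (f x)" by (simp add: indicator_def)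
qed

lemma integrable_indicator_T:
  fixes f :: "'x \<Rightarrow> complex"
  assumes f: "f \<in> L1 m" and A [measurable]: "A \<in> sets m" and w: "w \<in> space W"
  shows "integrable m (\<lambda>x. f x * indicator A (T w x))"
proof (rule Bochner_Integration.integrable_bound)
  show "integrable m f" using f by (simp add: L1_def)
  show "(\<lambda>x. f x * indicator A (T w x)) \<in> borel_measurable m"
    using L1_measurable[OF f] w by measurable
  show "AE x in m. cmod (f x * indicator A (T w x)) \<le> cmod (f x)" by (simp add: indicator_def)
qed

lemma integrable_indicator_T2:
  fixes f :: "'x \<Rightarrow> complex"
  assumes f: "f \<in> L1 m" and A [measurable]: "A \<in> sets m"
  shows "integrable W (\<lambda>w. LINT x|m. f x * indicator A (T w x))"
proof (rule Omega.integrable_const_bound[where B = "LINT x|m. cmod (f x)"])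
  note [measurable] = L1_measurable[OF f]
  show "AE w in W. cmod (LINT x|m. f x * indicator A (T w x)) \<le> (LINT x|m. cmod (f x))"
    using f[unfolded L1_def mem_Collect_eq] integrable_indicator_T[OF f A]
    by (intro AE_I2 integral_norm_bound[THEN order_trans] integral_mono)
      (auto simp: indicator_def)
qed (use L1_measurable[OF f] in measurable)

text \<open>
  The class of \<open>P f\<close> is determined by the duality against indicators alone.  Linearity
  of \<open>P\<close> and the invariance of a stationary density are read off from this.
\<close>

lemma P_unique:
  assumes f: "f \<in> L1 m" and q: "q \<in> L1 m"
    and eq: "\<And>A. A \<in> sets m \<Longrightarrow>
      (LINT x|m. q x * indicator A x) = (LINT w|W. LINT x|m. f x * indicator A (T w x))"
  shows "AE x in m. P f x = q x"
proof -
  have "AE x in m. P f x - q x = 0"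
  proof (rule AE_zero_if_set_integrals_zero)
    show "integrable m (\<lambda>x. P f x - q x)" using P_L1[OF f] q by (auto simp: L1_def)
    fix A assume A: "A \<in> sets m"
    have "(LINT x|m. (P f x - q x) * indicator A x)
        = (LINT x|m. P f x * indicator A x) - (LINT x|m. q x * indicator A x)"
      using integrable_indicator_mult[OF P_L1[OF f] A] integrable_indicator_mult[OF q A]
      by (simp add: left_diff_distrib)
    then show "(LINT x|m. (P f x - q x) * indicator A x) = 0"
      using transfer_set_duality[OF f A] eq[OF A] by simp
  qed
  then show ?thesis by simp
qed

lemma L1_lincomb: "f \<in> L1 m \<Longrightarrow> g \<in> L1 m \<Longrightarrow> (\<lambda>x. a * f x + b * g x) \<in> L1 m"
  by (auto simp: L1_def)

lemma P_lincomb: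
  assumes f: "f \<in> L1 m" and g: "g \<in> L1 m"
  shows "AE x in m. P (\<lambda>x. a * f x + b * g x) x = a * P f x + b * P g x"
proof (rule P_unique)
  fix A assume A: "A \<in> sets m"
  have "(LINT x|m. (a * P f x + b * P g x) * indicator A x)
      = a * (LINT x|m. P f x * indicator A x) + b * (LINT x|m. P g x * indicator A x)"
    using integrable_indicator_mult[OF P_L1[OF f] A] integrable_indicator_mult[OF P_L1[OF g] A]
    by (simp add: distrib_right mult.assoc)
  also have "\<dots> = (LINT w|W. a * (LINT x|m. f x * indicator A (T w x))
        + b * (LINT x|m. g x * indicator A (T w x)))"
    using integrable_indicator_T2[OF f A] integrable_indicator_T2[OF g A]
    by (simp add: transfer_set_duality f g A)
  also have "\<dots> = (LINT w|W. LINT x|m. (a * f x + b * g x) * indicator A (T w x))"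
    using integrable_indicator_T[OF f A] integrable_indicator_T[OF g A]
    by (intro Bochner_Integration.integral_cong) (auto simp: distrib_right mult.assoc)
  finally show "(LINT x|m. (a * P f x + b * P g x) * indicator A x) =
      (LINT w|W. LINT x|m. (a * f x + b * g x) * indicator A (T w x))" .
qed (use f g P_L1 L1_lincomb in auto)

lemma P_diff:
  assumes f: "f \<in> L1 m" and g: "g \<in> L1 m"
  shows "AE x in m. P (\<lambda>x. f x - g x) x = P f x - P g x"
  using P_lincomb[OF assms, of 1 "-1"] by simp

lemma integral_P: "f \<in> L1 m \<Longrightarrow> (LINT x|m. P f x) = (LINT x|m. f x)"
  using transfer_duality[of f "\<lambda>_. 1" 1] by (simp add: Omega.prob_space)

lemma P_stationary_density:
  assumes h [measurable]: "h \<in> borel_measurable m" and h0: "\<And>x. x \<in> space m \<Longrightarrow> 0 \<le> h x"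
    and hL1: "(\<lambda>x. complex_of_real (h x)) \<in> L1 m"
    and prob: "prob_space (density m (\<lambda>x. ennreal (h x)))"
    and stat: "stationary W T (density m (\<lambda>x. ennreal (h x)))"
  shows "AE x in m. P (\<lambda>x. complex_of_real (h x)) x = complex_of_real (h x)"
proof (rule P_unique[OF hL1 hL1])
  let ?D = "density m (\<lambda>x. ennreal (h x))"
  interpret D: prob_space ?D by fact
  have int: "(LINT x|m. of_real (h x) * indicator A x) = complex_of_real (measure ?D A)"
    if A [measurable]: "A \<in> sets m" for A
  proof -
    have "measure ?D A = (LINT x|?D. indicat_real A x)" using A by simp
    also have "\<dots> = (LINT x|m. h x * indicat_real A x)"
      using h0 by (subst integral_density) (auto intro!: AE_I2)
    also have "complex_of_real \<dots> = (LINT x|m. of_real (h x * indicat_real A x))"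
      by (rule integral_complex_of_real[symmetric])
    also have "\<dots> = (LINT x|m. of_real (h x) * indicator A x)"
      by (intro Bochner_Integration.integral_cong) (auto simp: indicator_def)
    finally show ?thesis ..
  qed
  fix A assume A [measurable]: "A \<in> sets m"
  have meas: "T w -` A \<inter> space m \<in> sets m" if [simp]: "w \<in> space W" for w
    by (rule measurable_sets[OF _ A]) measurable
  have inner: "(LINT x|m. of_real (h x) * indicator A (T w x))
      = complex_of_real (measure ?D (T w -` A \<inter> space m))" if w: "w \<in> space W" for w
    unfolding int[OF meas[OF w], symmetric]
    by (intro Bochner_Integration.integral_cong) (auto simp: indicator_def)
  have Dm: "(\<lambda>w. measure ?D (T w -` A \<inter> space m)) \<in> borel_measurable W"
  proof -
    have "(\<lambda>w. Re (LINT x|m. of_real (h x) * indicator A (T w x))) \<in> borel_measurable W"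
      by measurable
    then show ?thesis by (rule measurable_cong[THEN iffD1, rotated]) (simp add: inner)
  qed
  have "ennreal (measure ?D A) = (\<integral>\<^sup>+ w. ennreal (measure ?D (T w -` A \<inter> space m)) \<partial>W)"
    using stat A unfolding stationary_def by (simp add: D.emeasure_eq_measure)
  also have "\<dots> = ennreal (LINT w|W. measure ?D (T w -` A \<inter> space m))"
    using Dm by (intro nn_integral_eq_integral Omega.integrable_const_bound[where B = 1]) auto
  finally have "measure ?D A = (LINT w|W. measure ?D (T w -` A \<inter> space m))"
    by (subst (asm) ennreal_inj) auto
  then have "complex_of_real (measure ?D A)
      = (LINT w|W. complex_of_real (measure ?D (T w -` A \<inter> space m)))" by simp
  also have "\<dots> = (LINT w|W. LINT x|m. of_real (h x) * indicator A (T w x))"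
    by (intro Bochner_Integration.integral_cong) (auto simp: inner)
  finally show "(LINT x|m. of_real (h x) * indicator A x)
      = (LINT w|W. LINT x|m. complex_of_real (h x) * indicator A (T w x))"
    using int[OF A] by simp
qed

end

section \<open>Solving the Poisson equation in the Banach space\<close>

context banach_function_space
begin

lemma L1_mem: "f \<in> B \<Longrightarrow> f \<in> L1 m"
  using subset_L1 by auto

lemma lincomb_mem: "f \<in> B \<Longrightarrow> g \<in> B \<Longrightarrow> (\<lambda>x. a * f x + b * g x) \<in> B"
  using add_mem scale_mem by simp

lemma diff_mem: "f \<in> B \<Longrightarrow> g \<in> B \<Longrightarrow> (\<lambda>x. f x - g x) \<in> B"
  using lincomb_mem[of f g 1 "-1"] by simp

lemma nrm_minus: "f \<in> B \<Longrightarrow> nrm (\<lambda>x. - f x) = nrm f"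
  using nrm_scale[of f "-1"] by simp

lemma nrm_diff_triangle: "f \<in> B \<Longrightarrow> g \<in> B \<Longrightarrow> nrm (\<lambda>x. f x - g x) \<le> nrm f + nrm g"
  using nrm_triangle[of f "\<lambda>x. - g x"] scale_mem[of g "-1"] nrm_minus[of g] by simp

lemma nrm_le_add_diff: "f \<in> B \<Longrightarrow> g \<in> B \<Longrightarrow> nrm f \<le> nrm g + nrm (\<lambda>x. f x - g x)"
  using nrm_triangle[of g "\<lambda>x. f x - g x"] diff_mem by simp

lemma nrm_diff_commute: "f \<in> B \<Longrightarrow> g \<in> B \<Longrightarrow> nrm (\<lambda>x. f x - g x) = nrm (\<lambda>x. g x - f x)"
  using nrm_minus[of "\<lambda>x. f x - g x"] diff_mem[of f g] by simp

lemma nrm_cong_AE: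
  assumes "f \<in> B" "g \<in> B" "AE x in m. f x = g x"
  shows "nrm f = nrm g"
proof -
  have "nrm (\<lambda>x. f x - g x) = 0"
    using assms diff_mem by (subst nrm_eq_0_iff) auto
  moreover have "nrm (\<lambda>x. g x - f x) = 0"
    using assms diff_mem by (subst nrm_eq_0_iff) auto
  ultimately show ?thesis
    using nrm_le_add_diff[of f g] nrm_le_add_diff[of g f] assms by simp
qed

lemma convergent_if_gap_bound:
  assumes F: "\<And>n. F n \<in> B" and gap: "\<And>i j. nrm (\<lambda>x. F i x - F j x) \<le> e i + e j"
    and e: "e \<longlonglongrightarrow> (0 :: real)"
  shows "\<exists>f\<in>B. (\<lambda>n. nrm (\<lambda>x. F n x - f x)) \<longlonglongrightarrow> 0"
proof (rule complete[OF F])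
  fix d :: real assume "d > 0"
  then obtain M where "\<And>n. n \<ge> M \<Longrightarrow> \<bar>e n\<bar> < d / 2"
    using e[THEN LIMSEQ_D, of "d / 2"] by auto
  then have "nrm (\<lambda>x. F i x - F j x) < d" if "i \<ge> M" "j \<ge> M" for i j
    using gap[of i j] that by (smt (verit) field_sum_of_halves)
  then show "\<exists>M. \<forall>i\<ge>M. \<forall>j\<ge>M. nrm (\<lambda>x. F i x - F j x) < d" by blast
qed

end

locale annealed_operator_on_B = annealed_system W m T P + banach_function_space m B nrm
  for W :: "'w measure" and m :: "'x measure" and T :: "'w \<Rightarrow> 'x \<Rightarrow> 'x"
    and P :: "('x \<Rightarrow> complex) \<Rightarrow> ('x \<Rightarrow> complex)"
    and B :: "('x \<Rightarrow> complex) set" and nrm :: "('x \<Rightarrow> complex) \<Rightarrow> real" +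
  assumes compact: "compactly_embedded_in_L1 m B nrm"
    and P_mem: "\<And>f. f \<in> B \<Longrightarrow> P f \<in> B"
    and P_continuous: "\<exists>c. \<forall>f\<in>B. nrm (P f) \<le> c * nrm f"
    and lasota_yorke: "\<exists>N::nat. N \<ge> 1 \<and> (\<exists>\<rho> K. \<rho> < 1 \<and> K \<ge> 0 \<and>
              (\<forall>f\<in>B. nrm ((P ^^ N) f) \<le> \<rho> * nrm f + K * L1_norm m f))"
    and simple: "simple_eigenvalue m B P 1"
    and isolated: "isolated_in_spectrum m B nrm P 1"
begin

definition defect :: "('x \<Rightarrow> complex) \<Rightarrow> 'x \<Rightarrow> complex" where
  "defect u = (\<lambda>x. u x - P u x)"

lemma defect_mem: "u \<in> B \<Longrightarrow> defect u \<in> B"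
  unfolding defect_def by (intro diff_mem P_mem)

lemma integral_defect: "u \<in> B \<Longrightarrow> (LINT x|m. defect u x) = 0"
  using L1_mem[of u] P_L1[of u] integral_P[of u] by (simp add: defect_def L1_def)

lemma P_bound: obtains c where "c \<ge> 0" "\<And>f. f \<in> B \<Longrightarrow> nrm (P f) \<le> c * nrm f"
proof -
  obtain c where c: "\<And>f. f \<in> B \<Longrightarrow> nrm (P f) \<le> c * nrm f" using P_continuous by blast
  have "nrm (P f) \<le> max c 0 * nrm f" if "f \<in> B" for f
    using c[OF that] nrm_nonneg[OF that] by (meson max.cobounded1 mult_right_mono order_trans)
  then show thesis using that[of "max c 0"] by simp
qed

lemma defect_bound: obtains E where "E \<ge> 0" "\<And>f. f \<in> B \<Longrightarrow> nrm (defect f) \<le> E * nrm f"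
proof -
  obtain c where c: "c \<ge> 0" "\<And>f. f \<in> B \<Longrightarrow> nrm (P f) \<le> c * nrm f" by (rule P_bound) blast
  have "nrm (defect f) \<le> (1 + c) * nrm f" if "f \<in> B" for f
    using c(2)[OF that] nrm_diff_triangle[OF that P_mem[OF that]]
    by (simp add: defect_def distrib_right)
  then show thesis using that[of "1 + c"] c(1) by simp
qed

lemma L1_bound: obtains c where "c \<ge> 0" "\<And>f. f \<in> B \<Longrightarrow> L1_norm m f \<le> c * nrm f"
proof -
  obtain c where c: "\<And>f. f \<in> B \<Longrightarrow> L1_norm m f \<le> c * nrm f"
    using compact unfolding compactly_embedded_in_L1_def by blast
  have "L1_norm m f \<le> max c 0 * nrm f" if "f \<in> B" for f
    using c[OF that] nrm_nonneg[OF that] by (meson max.cobounded1 mult_right_mono order_trans)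
  then show thesis using that[of "max c 0"] by simp
qed

lemma defect_diff:
  assumes "f \<in> B" "g \<in> B"
  shows "AE x in m. defect (\<lambda>x. f x - g x) x = defect f x - defect g x"
  using P_diff[OF L1_mem[OF assms(1)] L1_mem[OF assms(2)]]
  by eventually_elim (simp add: defect_def)

lemma nrm_defect_diff:
  assumes "f \<in> B" "g \<in> B"
  shows "nrm (defect (\<lambda>x. f x - g x)) = nrm (\<lambda>x. defect f x - defect g x)"
  by (intro nrm_cong_AE defect_diff defect_mem diff_mem assms)

lemma nrm_defect_scale:
  assumes f: "f \<in> B"
  shows "nrm (defect (\<lambda>x. c * f x)) = cmod c * nrm (defect f)"
proof -
  have "AE x in m. defect (\<lambda>x. c * f x) x = c * defect f x"
    using P_lincomb[OF L1_mem[OF f] L1_mem[OF f], of c 0]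
    by eventually_elim (simp add: defect_def algebra_simps)
  then have "nrm (defect (\<lambda>x. c * f x)) = nrm (\<lambda>x. c * defect f x)"
    by (intro nrm_cong_AE defect_mem scale_mem f)
  then show ?thesis using nrm_scale[OF defect_mem[OF f]] by simp
qed

lemma nrm_iterate_defect:
  "\<exists>D\<ge>0. \<forall>u\<in>B. (P ^^ n) u \<in> B \<and> nrm (\<lambda>x. u x - (P ^^ n) u x) \<le> D * nrm (defect u)"
proof (induction n)
  case 0
  have "nrm (\<lambda>x. 0) = 0" using zero_mem by (subst nrm_eq_0_iff) auto
  then show ?case by (intro exI[of _ 0]) simp
next
  case (Suc n)
  obtain c where c: "c \<ge> 0" "\<And>f. f \<in> B \<Longrightarrow> nrm (P f) \<le> c * nrm f" by (rule P_bound) blast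
  from Suc obtain D where D: "D \<ge> 0"
    "\<And>u. u \<in> B \<Longrightarrow> (P ^^ n) u \<in> B"
    "\<And>u. u \<in> B \<Longrightarrow> nrm (\<lambda>x. u x - (P ^^ n) u x) \<le> D * nrm (defect u)" by blast
  have "nrm (\<lambda>x. u x - (P ^^ Suc n) u x) \<le> (1 + c * D) * nrm (defect u)" if u: "u \<in> B" for u
  proof -
    let ?v = "(P ^^ n) u"
    have v: "?v \<in> B" using D(2)[OF u] .
    have "nrm (\<lambda>x. u x - (P ^^ Suc n) u x) = nrm (\<lambda>x. defect u x + (P u x - P ?v x))"
      by (simp add: defect_def)
    also have "\<dots> \<le> nrm (defect u) + nrm (\<lambda>x. P u x - P ?v x)"
      by (intro nrm_triangle defect_mem diff_mem P_mem u v)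
    also have "nrm (\<lambda>x. P u x - P ?v x) = nrm (P (\<lambda>x. u x - ?v x))"
      using P_diff[OF L1_mem[OF u] L1_mem[OF v]]
      by (intro nrm_cong_AE diff_mem P_mem u v) (auto elim!: eventually_mono)
    also have "\<dots> \<le> c * nrm (\<lambda>x. u x - ?v x)" by (intro c(2) diff_mem u v)
    also have "\<dots> \<le> c * (D * nrm (defect u))" by (intro mult_left_mono D(3) u c(1))
    finally show ?thesis by (simp add: algebra_simps)
  qed
  then show ?case using c(1) D P_mem by (intro exI[of _ "1 + c * D"]) auto
qed

text \<open>
  Split \<open>u\<close> into \<open>u - P\<^sup>N u\<close>, which is controlled by \<open>u - P u\<close>, and \<open>P\<^sup>N u\<close>, to which the
  Lasota--Yorke inequality applies; since \<open>\<rho> < 1\<close>, its term \<open>\<rho> \<parallel>u\<parallel>\<close> is absorbed on the left.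
  So \<open>L\<^sup>1\<close> convergence of nearly fixed functions improves to convergence in \<open>B\<close>.
\<close>

lemma nrm_le_L1_plus_defect:
  obtains A D where "A \<ge> 0" "D \<ge> 0"
    "\<And>u. u \<in> B \<Longrightarrow> nrm u \<le> A * L1_norm m u + D * nrm (defect u)"
proof -
  obtain N \<rho> K where K: "\<rho> < 1" "K \<ge> 0"
    "\<And>f. f \<in> B \<Longrightarrow> nrm ((P ^^ N) f) \<le> \<rho> * nrm f + K * L1_norm m f"
    using lasota_yorke by blast
  obtain D where D: "D \<ge> 0" "\<And>u. u \<in> B \<Longrightarrow> (P ^^ N) u \<in> B"
    "\<And>u. u \<in> B \<Longrightarrow> nrm (\<lambda>x. u x - (P ^^ N) u x) \<le> D * nrm (defect u)"
    using nrm_iterate_defect[of N] by blast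
  have "nrm u \<le> K / (1 - \<rho>) * L1_norm m u + D / (1 - \<rho>) * nrm (defect u)" if u: "u \<in> B" for u
  proof -
    have "(1 - \<rho>) * nrm u \<le> K * L1_norm m u + D * nrm (defect u)"
      using nrm_le_add_diff[OF u D(2)[OF u]] K(3)[OF u] D(3)[OF u] by (simp add: algebra_simps)
    then have "nrm u \<le> (K * L1_norm m u + D * nrm (defect u)) / (1 - \<rho>)"
      using K(1) by (simp add: pos_le_divide_eq mult.commute)
    then show ?thesis by (simp add: add_divide_distrib)
  qed
  then show thesis using that[of "K / (1 - \<rho>)" "D / (1 - \<rho>)"] K D by simp
qed

lemma integral_zero_closed:
  assumes F: "\<And>n. F n \<in> B" and f: "f \<in> B" and lim: "(\<lambda>n. nrm (\<lambda>x. F n x - f x)) \<longlonglongrightarrow> 0"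
    and zero: "\<And>n. (LINT x|m. F n x) = 0"
  shows "(LINT x|m. f x) = 0"
proof -
  obtain c where c: "\<And>f. f \<in> B \<Longrightarrow> L1_norm m f \<le> c * nrm f" by (rule L1_bound) blast
  have "cmod (LINT x|m. f x) \<le> c * nrm (\<lambda>x. F n x - f x)" for n
  proof -
    have "(LINT x|m. F n x - f x) = - (LINT x|m. f x)"
      using L1_mem[OF F[of n]] L1_mem[OF f] zero[of n] by (simp add: L1_def)
    then have "cmod (LINT x|m. f x) \<le> L1_norm m (\<lambda>x. F n x - f x)"
      unfolding L1_norm_def using integral_norm_bound[of m "\<lambda>x. F n x - f x"] by simp
    then show ?thesis using c[OF diff_mem[OF F f]] by (rule order_trans)
  qed
  moreover have "(\<lambda>n. c * nrm (\<lambda>x. F n x - f x)) \<longlonglongrightarrow> c * 0"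
    by (intro tendsto_intros lim)
  ultimately have "cmod (LINT x|m. f x) \<le> c * 0"
    by (intro LIMSEQ_le_const[of _ "c * 0"]) auto
  then show ?thesis by simp
qed

lemma L1_norm_triangle_via:
  assumes "f \<in> L1 m" "g \<in> L1 m" "h \<in> L1 m"
  shows "L1_norm m (\<lambda>x. f x - g x) \<le> L1_norm m (\<lambda>x. f x - h x) + L1_norm m (\<lambda>x. g x - h x)"
proof -
  have "L1_norm m (\<lambda>x. f x - g x) \<le> (LINT x|m. cmod (f x - h x) + cmod (g x - h x))"
    unfolding L1_norm_def using assms norm_triangle_ineq4[of "f x - h x" "g x - h x" for x]
    by (intro integral_mono) (auto simp: L1_def)
  also have "\<dots> = L1_norm m (\<lambda>x. f x - h x) + L1_norm m (\<lambda>x. g x - h x)"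
    unfolding L1_norm_def using assms by (intro Bochner_Integration.integral_add) (auto simp: L1_def)
  finally show ?thesis .
qed

end

locale annealed_gap = annealed_operator_on_B W m T P B nrm
  for W :: "'w measure" and m :: "'x measure" and T :: "'w \<Rightarrow> 'x \<Rightarrow> 'x"
    and P :: "('x \<Rightarrow> complex) \<Rightarrow> ('x \<Rightarrow> complex)"
    and B :: "('x \<Rightarrow> complex) set" and nrm :: "('x \<Rightarrow> complex) \<Rightarrow> real" +
  fixes h :: "'x \<Rightarrow> complex"
  assumes h_mem: "h \<in> B" and P_h: "AE x in m. P h x = h x" and integral_h: "(LINT x|m. h x) = 1"
begin

text \<open>
  The integral separates \<open>h\<close> from \<open>0\<close>, so a mean-zero multiple of \<open>h\<close> vanishes.
\<close>

lemma fixed_mean_zero_vanishes: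
  assumes u: "u \<in> B" and Pu: "AE x in m. P u x = u x" and zero: "(LINT x|m. u x) = 0"
  shows "AE x in m. u x = 0"
proof (rule ccontr)
  assume non0: "\<not> (AE x in m. u x = 0)"
  have ev: "eigenvector m B P 1 u" using u Pu non0 by (simp add: eigenvector_def)
  have "\<not> (AE x in m. h x = 0)"
  proof
    assume "AE x in m. h x = 0"
    then have "(LINT x|m. h x) = 0" by (rule integral_eq_zero_AE)
    then show False using integral_h by simp
  qed
  then have evh: "eigenvector m B P 1 h" using h_mem P_h by (simp add: eigenvector_def)
  from simple obtain f where f: "eigenvector m B P 1 f"
    and span: "\<And>g. eigenvector m B P 1 g \<Longrightarrow> \<exists>c. AE x in m. g x = c * f x"
    unfolding simple_eigenvalue_def by blast
  obtain a b where a: "AE x in m. u x = a * f x" and b: "AE x in m. h x = b * f x"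
    using span[OF ev] span[OF evh] by blast
  have [measurable]: "f \<in> borel_measurable m" "u \<in> borel_measurable m" "h \<in> borel_measurable m"
    using f u h_mem L1_mem L1_measurable by (auto simp: eigenvector_def)
  have "(LINT x|m. u x) = (LINT x|m. a * f x)" by (rule integral_cong_AE) (use a in auto)
  moreover have "(LINT x|m. h x) = (LINT x|m. b * f x)" by (rule integral_cong_AE) (use b in auto)
  ultimately have "a = 0" using zero integral_h by auto
  then show False using a non0 by simp
qed

text \<open>
  If the bound failed, there would be normalised mean-zero functions that \<open>P\<close> nearly fixes.
  Compactness in \<open>L\<^sup>1\<close> together with the previous inequality makes a subsequence converge in \<open>B\<close>,
  to a normalised mean-zero fixed point, which simplicity of the eigenvalue forbids.
\<close>

lemma defect_bounded_below:
  obtains M where "M \<ge> 0"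
    "\<And>u. u \<in> B \<Longrightarrow> (LINT x|m. u x) = 0 \<Longrightarrow> nrm u \<le> M * nrm (defect u)"
proof -
  have "\<exists>M\<ge>0. \<forall>u\<in>B. (LINT x|m. u x) = 0 \<longrightarrow> nrm u \<le> M * nrm (defect u)"
  proof (rule ccontr)
    assume "\<not> ?thesis"
    then have "\<exists>u\<in>B. (LINT x|m. u x) = 0 \<and> nrm u > M * nrm (defect u)" if "M \<ge> 0" for M
      using that by force
    then have "\<forall>k::nat. \<exists>u\<in>B. (LINT x|m. u x) = 0 \<and> nrm u > real (Suc k) * nrm (defect u)"
      by (meson of_nat_0_le_iff)
    then obtain u where u: "\<And>k. u k \<in> B" "\<And>k. (LINT x|m. u k x) = 0"
      "\<And>k. nrm (u k) > real (Suc k) * nrm (defect (u k))" by metis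
    have u_pos: "nrm (u k) > 0" for k
      using u(3)[of k] nrm_nonneg[OF defect_mem[OF u(1)]]
      by (meson mult_nonneg_nonneg of_nat_0_le_iff order_le_less_trans)
    define U where "U k = (\<lambda>x. complex_of_real (inverse (nrm (u k))) * u k x)" for k
    have U: "U k \<in> B" "nrm (U k) = 1" "(LINT x|m. U k x) = 0" for k
      using u(1,2)[of k] u_pos[of k] nrm_scale[OF u(1)[of k], of "complex_of_real (inverse (nrm (u k)))"]
        scale_mem[OF u(1)]
      by (auto simp: U_def norm_inverse)
    have U_defect: "nrm (defect (U k)) \<le> inverse (real (Suc k))" for k
    proof -
      have "nrm (defect (U k)) = inverse (nrm (u k)) * nrm (defect (u k))"
        unfolding U_def using u_pos[of k] by (simp add: nrm_defect_scale[OF u(1)] norm_inverse)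
      also have "\<dots> \<le> inverse (nrm (u k)) * (nrm (u k) / real (Suc k))"
        using u(3)[of k] u_pos[of k]
        by (intro mult_left_mono) (simp_all add: pos_le_divide_eq mult.commute del: of_nat_Suc)
      also have "\<dots> = inverse (real (Suc k))" using u_pos[of k] by (simp add: field_simps)
      finally show ?thesis .
    qed
    have "\<forall>F :: nat \<Rightarrow> 'x \<Rightarrow> complex. \<forall>R. (\<forall>n. F n \<in> B \<and> nrm (F n) \<le> R) \<longrightarrow>
        (\<exists>r g. strict_mono r \<and> g \<in> L1 m \<and> (\<lambda>n. L1_norm m (\<lambda>x. F (r n) x - g x)) \<longlonglongrightarrow> 0)"
      using compact unfolding compactly_embedded_in_L1_def by blast
    from this[rule_format, of U 1] U obtain r g where r: "strict_mono r" and g: "g \<in> L1 m"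
      and lim: "(\<lambda>n. L1_norm m (\<lambda>x. U (r n) x - g x)) \<longlonglongrightarrow> 0"
      by auto
    obtain A D where A: "A \<ge> 0" and D: "D \<ge> 0"
      and AD: "\<And>u. u \<in> B \<Longrightarrow> nrm u \<le> A * L1_norm m u + D * nrm (defect u)"
      by (rule nrm_le_L1_plus_defect) blast
    have d0: "(\<lambda>n. nrm (defect (U (r n)))) \<longlonglongrightarrow> 0"
    proof (rule tendsto_sandwich[of "\<lambda>_. 0"])
      show "(\<lambda>n. inverse (real (Suc (r n)))) \<longlonglongrightarrow> 0"
        using LIMSEQ_subseq_LIMSEQ[OF LIMSEQ_inverse_real_of_nat r] by (simp add: o_def)
    qed (use U_defect nrm_nonneg[OF defect_mem[OF U(1)]] in auto)
    let ?e = "\<lambda>n. A * L1_norm m (\<lambda>x. U (r n) x - g x) + D * nrm (defect (U (r n)))"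
    have "\<exists>f\<in>B. (\<lambda>n. nrm (\<lambda>x. U (r n) x - f x)) \<longlonglongrightarrow> 0"
    proof (rule convergent_if_gap_bound)
      show "?e \<longlonglongrightarrow> 0"
        using tendsto_add[OF tendsto_mult_left[OF lim, of A] tendsto_mult_left[OF d0, of D]] by simp
      fix i j
      let ?v = "\<lambda>x. U (r i) x - U (r j) x"
      have "nrm ?v \<le> A * L1_norm m ?v + D * nrm (defect ?v)" by (intro AD diff_mem U)
      also have "\<dots> \<le> A * (L1_norm m (\<lambda>x. U (r i) x - g x) + L1_norm m (\<lambda>x. U (r j) x - g x))
          + D * (nrm (defect (U (r i))) + nrm (defect (U (r j))))"
        unfolding nrm_defect_diff[OF U(1) U(1)]
        by (intro add_mono mult_left_mono L1_norm_triangle_via nrm_diff_triangle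
              defect_mem L1_mem U g A D)
      finally show "nrm ?v \<le> ?e i + ?e j" by (simp add: algebra_simps)
    qed (rule U)
    then obtain f where f: "f \<in> B" and conv: "(\<lambda>n. nrm (\<lambda>x. U (r n) x - f x)) \<longlonglongrightarrow> 0" by blast
    have f0: "(LINT x|m. f x) = 0" by (rule integral_zero_closed[OF U(1) f conv U(3)])
    obtain E where E: "\<And>f. f \<in> B \<Longrightarrow> nrm (defect f) \<le> E * nrm f" by (rule defect_bound) blast
    have "nrm (defect f) \<le> nrm (defect (U (r n))) + E * nrm (\<lambda>x. U (r n) x - f x)" for n
    proof -
      have "nrm (defect f) \<le> nrm (defect (U (r n))) + nrm (\<lambda>x. defect f x - defect (U (r n)) x)"
        by (intro nrm_le_add_diff defect_mem f U)
      also have "nrm (\<lambda>x. defect f x - defect (U (r n)) x) = nrm (defect (\<lambda>x. U (r n) x - f x))"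
        by (simp add: nrm_defect_diff f U nrm_diff_commute[of "defect f"] defect_mem)
      also have "\<dots> \<le> E * nrm (\<lambda>x. U (r n) x - f x)" by (intro E diff_mem U f)
      finally show ?thesis by simp
    qed
    moreover have "(\<lambda>n. nrm (defect (U (r n))) + E * nrm (\<lambda>x. U (r n) x - f x)) \<longlonglongrightarrow> 0 + E * 0"
      by (intro tendsto_intros d0 conv)
    ultimately have "nrm (defect f) \<le> 0 + E * 0"
      by (intro LIMSEQ_le_const[of _ "0 + E * 0"]) auto
    then have "nrm (defect f) = 0" using nrm_nonneg[OF defect_mem[OF f]] by simp
    then have "AE x in m. P f x = f x"
      using nrm_eq_0_iff[OF defect_mem[OF f]] by (auto simp: defect_def elim!: eventually_mono)
    then have "AE x in m. f x = 0" by (intro fixed_mean_zero_vanishes f f0)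
    then have nf: "nrm f = 0" using nrm_eq_0_iff[OF f] by simp
    have "1 \<le> nrm (\<lambda>x. U (r n) x - f x)" for n
      using nrm_le_add_diff[OF U(1) f, of "r n"] U(2) nf by simp
    then have "(1::real) \<le> 0" by (intro LIMSEQ_le_const[OF conv]) auto
    then show False by simp
  qed
  then show thesis using that by blast
qed

text \<open>
  Isolation of the eigenvalue makes \<open>z - P\<close> onto for \<open>z\<close> near \<open>1\<close>.  The solutions of
  \<open>(z - P) f = v\<close> automatically have mean zero, stay bounded, and form a Cauchy sequence as
  \<open>z \<rightarrow> 1\<close>, by the lower bound for \<open>1 - P\<close>.
\<close>

theorem poisson_equation_solvable:
  assumes v: "v \<in> B" and v0: "(LINT x|m. v x) = 0"
  obtains w where "w \<in> B" "(LINT x|m. w x) = 0" "AE x in m. w x - P w x = v x"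
proof -
  obtain e where e: "e > 0"
    and res: "\<And>z. 0 < cmod (z - 1) \<Longrightarrow> cmod (z - 1) < e \<Longrightarrow> in_resolvent_set m B nrm P z"
    using isolated unfolding isolated_in_spectrum_def by blast
  obtain M where M: "M \<ge> 0"
    "\<And>u. u \<in> B \<Longrightarrow> (LINT x|m. u x) = 0 \<Longrightarrow> nrm u \<le> M * nrm (defect u)"
    by (rule defect_bounded_below) blast
  \<comment> \<open>The first bound keeps \<open>1 + \<epsilon> k\<close> in the punctured disc where the resolvent exists; the second
    gives \<open>M * \<epsilon> k \<le> 1 / 2\<close>, so that \<open>\<epsilon> k * f k\<close> can be absorbed when bounding \<open>f k\<close>.\<close>
  define \<delta> where "\<delta> = min (e / 2) (inverse (2 * (M + 1)))"
  have \<delta>: "\<delta> > 0" "\<delta> < e" using e M(1) by (auto simp: \<delta>_def)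
  have "M * \<delta> \<le> M * inverse (2 * (M + 1))" using M(1) by (intro mult_left_mono) (auto simp: \<delta>_def)
  also have "\<dots> \<le> 1 / 2" using M(1) by (simp add: field_simps)
  finally have M\<delta>: "M * \<delta> \<le> 1 / 2" .
  define \<epsilon> where "\<epsilon> k = \<delta> * inverse (real (Suc k))" for k
  have \<epsilon>: "\<epsilon> k > 0" "\<epsilon> k \<le> \<delta>" for k
  proof -
    show "\<epsilon> k > 0" using \<delta> by (simp add: \<epsilon>_def)
    have "inverse (real (Suc k)) \<le> 1" by (simp add: inverse_le_1_iff)
    then show "\<epsilon> k \<le> \<delta>" using \<delta> unfolding \<epsilon>_def by (intro mult_left_le) auto
  qed
  have \<epsilon>0: "\<epsilon> \<longlonglongrightarrow> 0"
    unfolding \<epsilon>_def using tendsto_mult_left[OF LIMSEQ_inverse_real_of_nat, of \<delta>] by simp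
  have "\<exists>f\<in>B. AE x in m. (1 + complex_of_real (\<epsilon> k)) * f x - P f x = v x" for k
    using res[of "1 + complex_of_real (\<epsilon> k)"] \<epsilon>[of k] \<delta> v unfolding in_resolvent_set_def by simp
  then obtain f where f: "\<And>k. f k \<in> B"
    and feq: "\<And>k. AE x in m. (1 + complex_of_real (\<epsilon> k)) * f k x - P (f k) x = v x" by metis
  have fd: "AE x in m. defect (f k) x = v x - complex_of_real (\<epsilon> k) * f k x" for k
    using feq[of k] by eventually_elim (simp add: defect_def algebra_simps)
  note meas [measurable] = L1_measurable[OF L1_mem]
  have f0: "(LINT x|m. f k x) = 0" for k
  proof -
    have "0 = (LINT x|m. v x - complex_of_real (\<epsilon> k) * f k x)"
      unfolding integral_defect[OF f[of k], symmetric]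
      using fd[of k] by (intro integral_cong_AE L1_measurable L1_mem defect_mem diff_mem scale_mem f v)
    also have "\<dots> = - complex_of_real (\<epsilon> k) * (LINT x|m. f k x)"
      using L1_mem[OF f[of k]] L1_mem[OF v] v0 by (simp add: L1_def)
    finally show ?thesis using \<epsilon>[of k] by simp
  qed
  have nd: "nrm (defect (f k)) = nrm (\<lambda>x. v x - complex_of_real (\<epsilon> k) * f k x)" for k
    by (intro nrm_cong_AE fd defect_mem diff_mem scale_mem f v)
  have ne: "nrm (\<lambda>x. complex_of_real (\<epsilon> k) * f k x) = \<epsilon> k * nrm (f k)" for k
    using nrm_scale[OF f, of "complex_of_real (\<epsilon> k)"] \<epsilon>(1)[of k] by simp
  define R where "R = 2 * M * nrm v"
  have bd: "nrm (f k) \<le> R" for k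
  proof -
    have "nrm (f k) \<le> M * nrm (defect (f k))" by (intro M f f0)
    also have "\<dots> \<le> M * (nrm v + \<epsilon> k * nrm (f k))"
      unfolding nd ne[symmetric] by (intro mult_left_mono M(1) nrm_diff_triangle scale_mem f v)
    also have "\<dots> = M * nrm v + (M * \<epsilon> k) * nrm (f k)" by (simp add: algebra_simps)
    also have "(M * \<epsilon> k) * nrm (f k) \<le> (1 / 2) * nrm (f k)"
    proof (rule mult_right_mono[OF _ nrm_nonneg[OF f]])
      show "M * \<epsilon> k \<le> 1 / 2" using M\<delta> mult_left_mono[OF \<epsilon>(2)[of k] M(1)] by simp
    qed
    finally show ?thesis by (simp add: R_def)
  qed
  have "\<exists>w\<in>B. (\<lambda>n. nrm (\<lambda>x. f n x - w x)) \<longlonglongrightarrow> 0"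
  proof (rule convergent_if_gap_bound[where e = "\<lambda>k. M * (\<epsilon> k * R)"])
    show "(\<lambda>k. M * (\<epsilon> k * R)) \<longlonglongrightarrow> 0"
      using tendsto_mult_left[OF tendsto_mult_right[OF \<epsilon>0, of R], of M] by simp
    fix i j
    let ?s = "\<lambda>k x. complex_of_real (\<epsilon> k) * f k x"
    have s: "?s k \<in> B" for k by (intro scale_mem f)
    have "nrm (\<lambda>x. f i x - f j x) \<le> M * nrm (defect (\<lambda>x. f i x - f j x))"
      using f0 L1_mem[OF f] by (intro M diff_mem f) (simp add: L1_def)
    also have "nrm (defect (\<lambda>x. f i x - f j x)) = nrm (\<lambda>x. ?s j x - ?s i x)"
    proof (rule nrm_cong_AE)
      show "AE x in m. defect (\<lambda>x. f i x - f j x) x = ?s j x - ?s i x"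
        using fd[of i] fd[of j] defect_diff[OF f[of i] f[of j]] by eventually_elim simp
    qed (intro defect_mem diff_mem f s)+
    also have "M * nrm (\<lambda>x. ?s j x - ?s i x) \<le> M * (\<epsilon> j * R + \<epsilon> i * R)"
    proof (rule mult_left_mono[OF _ M(1)])
      have "nrm (\<lambda>x. ?s j x - ?s i x) \<le> \<epsilon> j * nrm (f j) + \<epsilon> i * nrm (f i)"
        using nrm_diff_triangle[OF s s, of j i] unfolding ne .
      also have "\<dots> \<le> \<epsilon> j * R + \<epsilon> i * R"
        using \<epsilon>(1) by (intro add_mono mult_left_mono bd) (auto intro: less_imp_le)
      finally show "nrm (\<lambda>x. ?s j x - ?s i x) \<le> \<epsilon> j * R + \<epsilon> i * R" .
    qed
    finally show "nrm (\<lambda>x. f i x - f j x) \<le> M * (\<epsilon> i * R) + M * (\<epsilon> j * R)"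
      by (simp add: algebra_simps)
  qed (rule f)
  then obtain w where w: "w \<in> B" and conv: "(\<lambda>n. nrm (\<lambda>x. f n x - w x)) \<longlonglongrightarrow> 0" by blast
  have w0: "(LINT x|m. w x) = 0" by (rule integral_zero_closed[OF f w conv f0])
  obtain E where E: "\<And>f. f \<in> B \<Longrightarrow> nrm (defect f) \<le> E * nrm f" by (rule defect_bound) blast
  have dv: "(\<lambda>x. defect w x - v x) \<in> B" by (intro diff_mem defect_mem w v)
  have "nrm (\<lambda>x. defect w x - v x) \<le> \<epsilon> k * R + E * nrm (\<lambda>x. f k x - w x)" for k
  proof -
    let ?s = "\<lambda>x. complex_of_real (\<epsilon> k) * f k x"
    have "nrm (\<lambda>x. defect w x - v x) = nrm (\<lambda>x. (- 1) * (?s x + defect (\<lambda>x. f k x - w x) x))"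
    proof (rule nrm_cong_AE[OF dv])
      show "AE x in m. defect w x - v x = (- 1) * (?s x + defect (\<lambda>x. f k x - w x) x)"
        using fd[of k] defect_diff[OF f[of k] w] by eventually_elim simp
    qed (intro scale_mem add_mem defect_mem diff_mem f w)
    also have "\<dots> = nrm (\<lambda>x. ?s x + defect (\<lambda>x. f k x - w x) x)"
      by (subst nrm_scale) (auto intro!: add_mem scale_mem defect_mem diff_mem f w)
    also have "\<dots> \<le> nrm ?s + nrm (defect (\<lambda>x. f k x - w x))"
      by (intro nrm_triangle scale_mem defect_mem diff_mem f w)
    also have "\<dots> \<le> \<epsilon> k * R + E * nrm (\<lambda>x. f k x - w x)"
      unfolding ne using \<epsilon>(1)[of k]
      by (intro add_mono mult_left_mono bd E diff_mem f w) (auto intro: less_imp_le)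
    finally show ?thesis .
  qed
  moreover have "(\<lambda>k. \<epsilon> k * R + E * nrm (\<lambda>x. f k x - w x)) \<longlonglongrightarrow> 0 * R + E * 0"
    by (intro tendsto_intros \<epsilon>0 conv)
  ultimately have "nrm (\<lambda>x. defect w x - v x) \<le> 0 * R + E * 0"
    by (intro LIMSEQ_le_const[of _ "0 * R + E * 0"]) auto
  then have "nrm (\<lambda>x. defect w x - v x) = 0" using nrm_nonneg[OF dv] by simp
  then have "AE x in m. w x - P w x = v x"
    using nrm_eq_0_iff[OF dv] by (auto simp: defect_def elim!: eventually_mono)
  then show thesis using that w w0 by blast
qed

end

section \<open>Pairing a density with a function of the random orbit\<close>

context annealed_system
begin

abbreviation Seq :: "(nat \<Rightarrow> 'w) measure" where
  "Seq \<equiv> \<Pi>\<^sub>M k\<in>UNIV. W"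

sublocale Seq: prob_space Seq
  by (intro prob_space_PiM Omega.prob_space_axioms)

sublocale Seq_X: pair_prob_space Seq m ..

sublocale W_Seq: pair_prob_space W Seq ..

definition shift :: "(nat \<Rightarrow> 'w) \<times> 'x \<Rightarrow> (nat \<Rightarrow> 'w) \<times> 'x" where
  "shift z = (\<lambda>k. fst z (Suc k), T (fst z 0) (snd z))"

lemma shift_measurable [measurable]: "shift \<in> measurable (Seq \<Otimes>\<^sub>M m) (Seq \<Otimes>\<^sub>M m)"
proof -
  have "(\<lambda>z. fst z k) \<in> measurable (Seq \<Otimes>\<^sub>M m) W" for k
    by (rule measurable_compose[OF measurable_fst measurable_component_singleton]) simp
  then show ?thesis
    unfolding shift_def by (intro measurable_Pair measurable_abs_UNIV T_measurable2 measurable_snd)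
qed

definition bounded_fun :: "real \<Rightarrow> ((nat \<Rightarrow> 'w) \<times> 'x \<Rightarrow> complex) \<Rightarrow> bool" where
  "bounded_fun c G \<longleftrightarrow>
     G \<in> borel_measurable (Seq \<Otimes>\<^sub>M m) \<and> (\<forall>z\<in>space (Seq \<Otimes>\<^sub>M m). cmod (G z) \<le> c)"

text \<open>
  For a probability density \<open>f\<close> this is the expectation of \<open>G\<close> when the initial point has law
  \<open>f m\<close>.  Allowing complex \<open>f\<close> lets the solutions of Poisson equations take the place of a density.
\<close>
definition pairing :: "('x \<Rightarrow> complex) \<Rightarrow> ((nat \<Rightarrow> 'w) \<times> 'x \<Rightarrow> complex) \<Rightarrow> complex" where
  "pairing f G = (LINT z|(Seq \<Otimes>\<^sub>M m). f (snd z) * G z)"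

lemma bounded_funD:
  assumes "bounded_fun c G"
  shows "G \<in> borel_measurable (Seq \<Otimes>\<^sub>M m)" "\<And>z. z \<in> space (Seq \<Otimes>\<^sub>M m) \<Longrightarrow> cmod (G z) \<le> c"
  using assms by (auto simp: bounded_fun_def)

lemma bounded_fun_shift: "bounded_fun c G \<Longrightarrow> bounded_fun c (\<lambda>z. G (shift z))"
  using measurable_space[OF shift_measurable]
  by (auto simp: bounded_fun_def intro!: measurable_compose[OF shift_measurable])

lemma bounded_fun_mult:
  assumes F: "bounded_fun c F" and G: "bounded_fun d G"
  shows "bounded_fun (c * d) (\<lambda>z. F z * G z)"
  unfolding bounded_fun_def
proof (intro conjI ballI)
  show "(\<lambda>z. F z * G z) \<in> borel_measurable (Seq \<Otimes>\<^sub>M m)"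
    using bounded_funD(1)[OF F] bounded_funD(1)[OF G] by measurable
  fix z assume z: "z \<in> space (Seq \<Otimes>\<^sub>M m)"
  have "0 \<le> c" using bounded_funD(2)[OF F z] norm_ge_zero order_trans by blast
  then show "cmod (F z * G z) \<le> c * d"
    unfolding norm_mult using bounded_funD(2)[OF F z] bounded_funD(2)[OF G z]
    by (intro mult_mono) auto
qed

lemma bounded_fun_add:
  assumes F: "bounded_fun c F" and G: "bounded_fun d G"
  shows "bounded_fun (c + d) (\<lambda>z. F z + G z)"
  unfolding bounded_fun_def
proof (intro conjI ballI)
  show "(\<lambda>z. F z + G z) \<in> borel_measurable (Seq \<Otimes>\<^sub>M m)"
    using bounded_funD(1)[OF F] bounded_funD(1)[OF G] by measurable
  fix z assume z: "z \<in> space (Seq \<Otimes>\<^sub>M m)"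
  then show "cmod (F z + G z) \<le> c + d"
    using bounded_funD(2)[OF F z] bounded_funD(2)[OF G z] norm_triangle_mono by blast
qed

lemma integral_snd_Seq:
  fixes f :: "'x \<Rightarrow> 'b::{banach, second_countable_topology}"
  assumes f: "integrable m f"
  shows "integrable (Seq \<Otimes>\<^sub>M m) (\<lambda>z. f (snd z))"
    "(LINT z|(Seq \<Otimes>\<^sub>M m). f (snd z)) = (LINT x|m. f x)"
proof -
  note [measurable] = borel_measurable_integrable[OF f]
  show i: "integrable (Seq \<Otimes>\<^sub>M m) (\<lambda>z. f (snd z))"
  proof (rule integrableI_bounded)
    have "(\<integral>\<^sup>+ z. ennreal (norm (f (snd z))) \<partial>(Seq \<Otimes>\<^sub>M m)) = (\<integral>\<^sup>+ x. ennreal (norm (f x)) \<partial>m)"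
      by (subst X.nn_integral_fst[symmetric]) (simp_all add: Seq.emeasure_space_1)
    then show "(\<integral>\<^sup>+ z. ennreal (norm (f (snd z))) \<partial>(Seq \<Otimes>\<^sub>M m)) < \<infinity>"
      using f by (simp add: integrable_iff_bounded)
  qed measurable
  have "(LINT z|(Seq \<Otimes>\<^sub>M m). f (snd z)) = (LINT w|Seq. LINT x|m. f x)"
    using Seq_X.integral_fst'[OF i] by simp
  then show "(LINT z|(Seq \<Otimes>\<^sub>M m). f (snd z)) = (LINT x|m. f x)" by (simp add: Seq.prob_space)
qed

lemma pairing_integrable:
  assumes f: "f \<in> L1 m" and G: "bounded_fun c G"
  shows "integrable (Seq \<Otimes>\<^sub>M m) (\<lambda>z. f (snd z) * G z)"
proof (rule Bochner_Integration.integrable_bound)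
  note [measurable] = L1_measurable[OF f] bounded_funD(1)[OF G]
  show "integrable (Seq \<Otimes>\<^sub>M m) (\<lambda>z. c * cmod (f (snd z)))"
    using f by (intro integrable_mult_right integral_snd_Seq(1)) (auto simp: L1_def)
  show "(\<lambda>z. f (snd z) * G z) \<in> borel_measurable (Seq \<Otimes>\<^sub>M m)" by measurable
  show "AE z in Seq \<Otimes>\<^sub>M m. norm (f (snd z) * G z) \<le> norm (c * cmod (f (snd z)))"
  proof (rule AE_I2)
    fix z assume "z \<in> space (Seq \<Otimes>\<^sub>M m)"
    then have "cmod (G z) \<le> \<bar>c\<bar>" using bounded_funD(2)[OF G, of z] by linarith
    then show "norm (f (snd z) * G z) \<le> norm (c * cmod (f (snd z)))"
      by (simp add: norm_mult abs_mult mult.commute mult_right_mono)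
  qed
qed

lemma pairing_bound:
  assumes f: "f \<in> L1 m" and G: "bounded_fun c G"
  shows "cmod (pairing f G) \<le> c * L1_norm m f"
proof -
  have i: "integrable (Seq \<Otimes>\<^sub>M m) (\<lambda>z. cmod (f (snd z)))"
    using f by (intro integral_snd_Seq(1)) (auto simp: L1_def)
  have "cmod (pairing f G) \<le> (LINT z|(Seq \<Otimes>\<^sub>M m). cmod (f (snd z) * G z))"
    unfolding pairing_def by (rule integral_norm_bound)
  also have "\<dots> \<le> (LINT z|(Seq \<Otimes>\<^sub>M m). c * cmod (f (snd z)))"
  proof (rule integral_mono)
    show "cmod (f (snd z) * G z) \<le> c * cmod (f (snd z))" if "z \<in> space (Seq \<Otimes>\<^sub>M m)" for z
      using mult_right_mono[OF bounded_funD(2)[OF G that], of "cmod (f (snd z))"]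
      by (simp add: norm_mult mult.commute)
  qed (use pairing_integrable[OF f G] i in auto)
  also have "\<dots> = c * L1_norm m f"
    using f by (simp add: L1_norm_def integral_snd_Seq(2)[of "\<lambda>x. cmod (f x)"] L1_def)
  finally show ?thesis .
qed

lemma pairing_lincomb:
  assumes f: "f \<in> L1 m" and g: "g \<in> L1 m" and G: "bounded_fun c G"
  shows "pairing (\<lambda>x. a * f x + b * g x) G = a * pairing f G + b * pairing g G"
  unfolding pairing_def using pairing_integrable[OF f G] pairing_integrable[OF g G]
  by (simp add: distrib_right mult.assoc)

lemma pairing_diff:
  assumes "f \<in> L1 m" "g \<in> L1 m" "bounded_fun c G"
  shows "pairing (\<lambda>x. f x - g x) G = pairing f G - pairing g G"
  using pairing_lincomb[OF assms, of 1 "-1"] by simp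

lemma pairing_add_right:
  assumes f: "f \<in> L1 m" and F: "bounded_fun c F" and G: "bounded_fun d G"
  shows "pairing f (\<lambda>z. F z + G z) = pairing f F + pairing f G"
  unfolding pairing_def using pairing_integrable[OF f F] pairing_integrable[OF f G]
  by (simp add: distrib_left)

lemma pairing_scale_right: "pairing f (\<lambda>z. a * G z) = a * pairing f G"
  unfolding pairing_def by (subst integral_mult_right_zero[symmetric]) (simp add: mult.left_commute)

lemma pairing_mult_left: "pairing f (\<lambda>z. u (snd z) * G z) = pairing (\<lambda>x. u x * f x) G"
  unfolding pairing_def by (simp add: mult_ac)

lemma pairing_one: "f \<in> L1 m \<Longrightarrow> pairing f (\<lambda>_. 1) = (LINT x|m. f x)"
  unfolding pairing_def by (simp add: L1_def integral_snd_Seq(2))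

lemma pairing_Fubini:
  assumes f: "f \<in> L1 m" and G: "bounded_fun c G"
  shows "pairing f G = (LINT w|Seq. LINT x|m. f x * G (w, x))"
  unfolding pairing_def using Seq_X.integral_fst'[OF pairing_integrable[OF f G]] by simp

lemma pairing_cong_AE:
  assumes f: "f \<in> L1 m" and g: "g \<in> L1 m" and eq: "AE x in m. f x = g x" and G: "bounded_fun c G"
  shows "pairing f G = pairing g G"
  unfolding pairing_Fubini[OF f G] pairing_Fubini[OF g G]
proof (rule Bochner_Integration.integral_cong[OF refl])
  fix w assume [simp]: "w \<in> space Seq"
  note [measurable] = L1_measurable[OF f] L1_measurable[OF g] bounded_funD(1)[OF G]
  have [measurable]: "(\<lambda>x. G (w, x)) \<in> borel_measurable m"
    by (rule measurable_compose[OF measurable_Pair1' bounded_funD(1)[OF G]]) simp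
  show "(LINT x|m. f x * G (w, x)) = (LINT x|m. g x * G (w, x))"
    using eq by (intro integral_cong_AE) (auto elim!: eventually_mono)
qed

text \<open>
  The Markov property in transfer-operator form.  The first map of the sequence is independent of
  the remaining ones; integrating it out for a fixed tail turns \<open>f\<close> into \<open>P f\<close>.
\<close>

theorem pairing_shift:
  assumes f: "f \<in> L1 m" and G: "bounded_fun c G"
  shows "pairing f (\<lambda>z. G (shift z)) = pairing (P f) G"
proof -
  interpret W_seq: sequence_space W ..
  note [measurable] = L1_measurable[OF f] bounded_funD(1)[OF G]
  note GS = bounded_fun_shift[OF G]
  note [measurable] = bounded_funD(1)[OF GS]
  let ?F = "\<lambda>a w. LINT x|m. f x * G (w, T a x)"
  have in_space: "(w, T a x) \<in> space (Seq \<Otimes>\<^sub>M m)"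
    if "a \<in> space W" "w \<in> space Seq" "x \<in> space m" for a w x
    using that measurable_space[OF measurable_T, of "(a, x)"] by (simp add: space_pair_measure)
  have "(\<lambda>z. G (snd (fst z), T (fst (fst z)) (snd z))) \<in> borel_measurable ((W \<Otimes>\<^sub>M Seq) \<Otimes>\<^sub>M m)"
    by (rule measurable_compose[OF _ bounded_funD(1)[OF G]]) measurable
  then have "(\<lambda>z. LINT x|m. f x * G (snd z, T (fst z) x)) \<in> borel_measurable (W \<Otimes>\<^sub>M Seq)"
    by (intro X.borel_measurable_lebesgue_integral) (simp add: split_beta')
  then have Fm: "(\<lambda>(a, w). ?F a w) \<in> borel_measurable (W \<Otimes>\<^sub>M Seq)"
    by (simp add: split_beta')
  have Gw: "(\<lambda>x. G (w, x)) \<in> borel_measurable m" if "w \<in> space Seq" for w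
    using that by (intro measurable_compose[OF measurable_Pair1' bounded_funD(1)[OF G]])
  have Fint: "integrable (W \<Otimes>\<^sub>M Seq) (\<lambda>(a, w). ?F a w)"
  proof (rule W_Seq.integrable_const_bound[where B = "LINT x|m. \<bar>c\<bar> * cmod (f x)"])
    show "AE z in W \<Otimes>\<^sub>M Seq. norm (case z of (a, w) \<Rightarrow> ?F a w) \<le> (LINT x|m. \<bar>c\<bar> * cmod (f x))"
    proof (rule AE_I2)
      fix z assume "z \<in> space (W \<Otimes>\<^sub>M Seq)"
      then obtain a w where z: "z = (a, w)" and a [simp]: "a \<in> space W" and w: "w \<in> space Seq"
        by (auto simp: space_pair_measure)
      have i: "integrable m (\<lambda>x. \<bar>c\<bar> * cmod (f x))" using f by (auto simp: L1_def)
      have bd: "norm (f x * G (w, T a x)) \<le> \<bar>c\<bar> * cmod (f x)" if "x \<in> space m" for x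
      proof -
        have "cmod (G (w, T a x)) \<le> \<bar>c\<bar>" using bounded_funD(2)[OF G in_space[OF a w that]] by simp
        from mult_right_mono[OF this, of "cmod (f x)"] show ?thesis
          by (simp add: norm_mult mult.commute)
      qed
      have [measurable]: "(\<lambda>x. G (w, T a x)) \<in> borel_measurable m"
        by (rule measurable_compose[OF _ Gw[OF w]]) measurable
      have j: "integrable m (\<lambda>x. norm (f x * G (w, T a x)))"
        by (rule Bochner_Integration.integrable_bound[OF i]) (use bd in \<open>auto intro!: AE_I2\<close>)
      show "norm (case z of (a, w) \<Rightarrow> ?F a w) \<le> (LINT x|m. \<bar>c\<bar> * cmod (f x))"
        unfolding z prod.case
        by (rule integral_norm_bound[THEN order_trans], rule integral_mono[OF j i bd])
    qed
  qed (rule Fm)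
  have meas_cons: "(\<lambda>(s, w). case_nat s w) \<in> measurable (W \<Otimes>\<^sub>M Seq) Seq"
    by measurable
  have "pairing f (\<lambda>z. G (shift z)) = (LINT w|Seq. LINT x|m. f x * G (shift (w, x)))"
    by (rule pairing_Fubini[OF f GS])
  also have "\<dots> = (LINT w|distr (W \<Otimes>\<^sub>M Seq) Seq (\<lambda>(s, w). case_nat s w).
      LINT x|m. f x * G (shift (w, x)))"
    by (simp only: W_seq.PiM_iter)
  also have "\<dots> = (LINT z|(W \<Otimes>\<^sub>M Seq). LINT x|m. f x * G (shift ((case z of (s, w) \<Rightarrow> case_nat s w), x)))"
    by (rule integral_distr[OF meas_cons]) measurable
  also have "\<dots> = (LINT z|(W \<Otimes>\<^sub>M Seq). (case z of (a, w) \<Rightarrow> ?F a w))"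
    by (intro Bochner_Integration.integral_cong refl) (simp add: shift_def split: prod.split)
  also have "\<dots> = (LINT w|Seq. LINT a|W. ?F a w)"
    using W_Seq.integral_snd[OF Fint] by simp
  also have "\<dots> = (LINT w|Seq. LINT x|m. P f x * G (w, x))"
  proof (rule Bochner_Integration.integral_cong[OF refl])
    fix w assume w: "w \<in> space Seq"
    show "(LINT a|W. ?F a w) = (LINT x|m. P f x * G (w, x))"
      using w bounded_funD(2)[OF G]
      by (intro transfer_duality[OF f Gw[OF w], symmetric]) (auto simp: space_pair_measure)
  qed
  also have "\<dots> = pairing (P f) G"
    by (rule pairing_Fubini[OF P_L1[OF f] G, symmetric])
  finally show ?thesis .
qed

lemma integral_annealed_measure:
  fixes G :: "(nat \<Rightarrow> 'w) \<times> 'x \<Rightarrow> complex"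
  assumes h [measurable]: "h \<in> borel_measurable m" and h0: "\<And>x. x \<in> space m \<Longrightarrow> 0 \<le> h x"
    and hL1: "(\<lambda>x. complex_of_real (h x)) \<in> L1 m"
    and prob: "prob_space (density m (\<lambda>x. ennreal (h x)))"
    and G: "bounded_fun c G"
  shows "(LINT z|annealed_measure W (density m (\<lambda>x. ennreal (h x))). G z)
       = pairing (\<lambda>x. complex_of_real (h x)) G"
proof -
  let ?D = "density m (\<lambda>x. ennreal (h x))"
  note Gm = bounded_funD(1)[OF G]
  interpret D: prob_space ?D by fact
  interpret SD: pair_prob_space Seq ?D ..
  have sets_eq: "sets (Seq \<Otimes>\<^sub>M ?D) = sets (Seq \<Otimes>\<^sub>M m)"
    by (intro sets_pair_measure_cong) auto
  have sp: "space (Seq \<Otimes>\<^sub>M ?D) = space (Seq \<Otimes>\<^sub>M m)"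
    using sets_eq_imp_space_eq[OF sets_eq] .
  have "integrable (Seq \<Otimes>\<^sub>M ?D) G"
  proof (rule SD.integrable_const_bound[where B = c])
    show "G \<in> borel_measurable (Seq \<Otimes>\<^sub>M ?D)"
      using Gm measurable_cong_sets[OF sets_eq refl] by blast
    show "AE z in Seq \<Otimes>\<^sub>M ?D. norm (G z) \<le> c"
      by (rule AE_I2) (simp add: sp bounded_funD(2)[OF G])
  qed
  then have "(LINT z|annealed_measure W ?D. G z) = (LINT w|Seq. LINT x|?D. G (w, x))"
    unfolding annealed_measure_def by (rule SD.integral_fst'[symmetric])
  also have "\<dots> = (LINT w|Seq. LINT x|m. complex_of_real (h x) * G (w, x))"
  proof (rule Bochner_Integration.integral_cong[OF refl])
    fix w assume "w \<in> space Seq"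
    then have "(\<lambda>x. G (w, x)) \<in> borel_measurable m"
      by (intro measurable_compose[OF measurable_Pair1' Gm])
    then show "(LINT x|?D. G (w, x)) = (LINT x|m. complex_of_real (h x) * G (w, x))"
      using h0 by (subst integral_density) (auto simp: scaleR_conv_of_real)
  qed
  also have "\<dots> = pairing (\<lambda>x. complex_of_real (h x)) G"
    by (rule pairing_Fubini[OF hL1 G, symmetric])
  finally show ?thesis .
qed

end

section \<open>Birkhoff sums along the shift\<close>

lemma random_orbit_Suc_shift:
  "random_orbit T w (Suc k) x = random_orbit T (\<lambda>i. w (Suc i)) k (T (w 0) x)"
  by (induction k) auto

locale annealed_observable = annealed_system W m T P
  for W :: "'w measure" and m :: "'x measure" and T :: "'w \<Rightarrow> 'x \<Rightarrow> 'x"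
    and P :: "('x \<Rightarrow> complex) \<Rightarrow> ('x \<Rightarrow> complex)" +
  fixes \<phi> :: "'x \<Rightarrow> real" and b :: real
  assumes \<phi>_measurable [measurable]: "\<phi> \<in> borel_measurable m"
    and \<phi>_bound: "\<And>x. x \<in> space m \<Longrightarrow> \<bar>\<phi> x\<bar> \<le> b"
begin

abbreviation S :: "nat \<Rightarrow> (nat \<Rightarrow> 'w) \<times> 'x \<Rightarrow> real" where
  "S \<equiv> birkhoff_sum T \<phi>"

lemma b_nonneg: "0 \<le> b"
proof -
  obtain x where "x \<in> space m" using X.not_empty by blast
  then show ?thesis using \<phi>_bound[of x] by simp
qed

lemma orbit_measurable [measurable]:
  "(\<lambda>z. random_orbit T (fst z) k (snd z)) \<in> measurable (Seq \<Otimes>\<^sub>M m) m"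
proof (induction k)
  case (Suc k)
  note [measurable] = Suc
  show ?case unfolding random_orbit.simps by measurable
qed simp

lemma S_eq: "S n z = (\<Sum>k<n. \<phi> (random_orbit T (fst z) k (snd z)))"
  by (simp add: birkhoff_sum_def split_beta)

lemma S_0 [simp]: "S 0 z = 0"
  by (simp add: S_eq)

lemma S_measurable [measurable]: "S n \<in> borel_measurable (Seq \<Otimes>\<^sub>M m)"
  unfolding S_eq[abs_def] by measurable

lemma orbit_bound: "z \<in> space (Seq \<Otimes>\<^sub>M m) \<Longrightarrow> \<bar>\<phi> (random_orbit T (fst z) k (snd z))\<bar> \<le> b"
  by (intro \<phi>_bound measurable_space[OF orbit_measurable])

lemma S_bound:
  assumes "z \<in> space (Seq \<Otimes>\<^sub>M m)"
  shows "\<bar>S n z\<bar> \<le> real n * b"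
proof -
  have "\<bar>S n z\<bar> \<le> (\<Sum>k<n. \<bar>\<phi> (random_orbit T (fst z) k (snd z))\<bar>)"
    unfolding S_eq by (rule sum_abs)
  also have "\<dots> \<le> (\<Sum>k<n. b)" by (intro sum_mono orbit_bound assms)
  finally show ?thesis by simp
qed

lemma S_Suc_shift: "S (Suc n) z = \<phi> (snd z) + S n (shift z)"
proof -
  have "S (Suc n) z = \<phi> (snd z) + (\<Sum>k<n. \<phi> (random_orbit T (fst z) (Suc k) (snd z)))"
    unfolding S_eq by (subst sum.lessThan_Suc_shift) simp
  then show ?thesis by (simp add: S_eq shift_def random_orbit_Suc_shift del: random_orbit.simps(2))
qed

lemma S_Suc_diff_bound:
  assumes "z \<in> space (Seq \<Otimes>\<^sub>M m)"
  shows "\<bar>S (Suc n) z - S n z\<bar> \<le> b"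
  using orbit_bound[OF assms, of n] by (simp add: S_eq del: random_orbit.simps)

lemma S_shift_diff_bound:
  assumes "z \<in> space (Seq \<Otimes>\<^sub>M m)"
  shows "\<bar>S n (shift z) - S n z\<bar> \<le> 2 * b"
  using S_Suc_diff_bound[OF assms, of n] S_Suc_shift[of n z] orbit_bound[OF assms, of 0] by simp

end

section \<open>The variance\<close>

locale annealed_clt =
    annealed_gap W m T P B nrm h + annealed_observable W m T P \<phi> b
  for W :: "'w measure" and m :: "'x measure" and T :: "'w \<Rightarrow> 'x \<Rightarrow> 'x"
    and P :: "('x \<Rightarrow> complex) \<Rightarrow> ('x \<Rightarrow> complex)"
    and B :: "('x \<Rightarrow> complex) set" and nrm :: "('x \<Rightarrow> complex) \<Rightarrow> real"
    and h :: "'x \<Rightarrow> complex" and \<phi> :: "'x \<Rightarrow> real" and b :: real +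
  assumes \<phi>_mult: "\<And>f. f \<in> B \<Longrightarrow> (\<lambda>x. complex_of_real (\<phi> x) * f x) \<in> B"
    and \<phi>_mean: "(LINT x|m. complex_of_real (\<phi> x) * h x) = 0"
begin

definition corrector :: "('x \<Rightarrow> complex) \<Rightarrow> bool" where
  "corrector v \<longleftrightarrow> v \<in> B \<and> (LINT x|m. v x) = 0 \<and>
     (AE x in m. v x - P v x = P (\<lambda>x. complex_of_real (\<phi> x) * h x) x)"

text \<open>
  Formally \<open>v = (\<Sum>n\<ge>1. P\<^sup>n (\<phi> h))\<close>, so that this is the Green--Kubo formula
  \<open>\<integral> \<phi>\<^sup>2 d\<mu> + 2 (\<Sum>n\<ge>1. \<integral> \<phi> U\<^sup>n \<phi> d\<mu>)\<close>.
\<close>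
definition green_kubo :: "('x \<Rightarrow> complex) \<Rightarrow> complex" where
  "green_kubo v = (LINT x|m. complex_of_real (\<phi> x)^2 * h x)
     + 2 * (LINT x|m. complex_of_real (\<phi> x) * v x)"

lemma \<phi>_L1:
  assumes f: "f \<in> L1 m"
  shows "(\<lambda>x. complex_of_real (\<phi> x) * f x) \<in> L1 m"
  unfolding L1_def mem_Collect_eq
proof (rule Bochner_Integration.integrable_bound)
  note [measurable] = L1_measurable[OF f]
  show "integrable m (\<lambda>x. b * cmod (f x))" using f by (auto simp: L1_def)
  show "AE x in m. cmod (complex_of_real (\<phi> x) * f x) \<le> norm (b * cmod (f x))"
    using \<phi>_bound b_nonneg by (intro AE_I2) (simp add: norm_mult mult_right_mono)
  show "(\<lambda>x. complex_of_real (\<phi> x) * f x) \<in> borel_measurable m" by measurable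
qed

lemma \<phi>2_mult: "f \<in> B \<Longrightarrow> (\<lambda>x. complex_of_real (\<phi> x)^2 * f x) \<in> B"
  using \<phi>_mult[OF \<phi>_mult, of f] by (simp add: power2_eq_square mult.assoc)

lemma \<phi>2_L1: "f \<in> L1 m \<Longrightarrow> (\<lambda>x. complex_of_real (\<phi> x)^2 * f x) \<in> L1 m"
  using \<phi>_L1[OF \<phi>_L1, of f] by (simp add: power2_eq_square mult.assoc)

lemma h_L1: "h \<in> L1 m"
  by (rule L1_mem[OF h_mem])

lemma corrector_exists: obtains v where "corrector v"
proof -
  have "(LINT x|m. P (\<lambda>x. complex_of_real (\<phi> x) * h x) x) = 0"
    using integral_P[OF \<phi>_L1[OF h_L1]] \<phi>_mean by simp
  then show thesis
    using poisson_equation_solvable[OF P_mem[OF \<phi>_mult[OF h_mem]]] that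
    unfolding corrector_def by metis
qed

lemma bounded_fun_S: "bounded_fun (real n * b) (\<lambda>z. complex_of_real (S n z))"
  unfolding bounded_fun_def using S_bound by (auto simp del: of_nat_mult)

lemma bounded_fun_one: "bounded_fun 1 (\<lambda>_. 1)"
  by (simp add: bounded_fun_def)

lemma bounded_fun_\<phi>: "bounded_fun b (\<lambda>z. complex_of_real (\<phi> (snd z)))"
  unfolding bounded_fun_def using \<phi>_bound by (auto simp: space_pair_measure)

lemma first_moment_Suc:
  assumes f: "f \<in> L1 m"
  shows "pairing f (\<lambda>z. complex_of_real (S (Suc n) z))
    = (LINT x|m. complex_of_real (\<phi> x) * f x) + pairing (P f) (\<lambda>z. complex_of_real (S n z))"
proof -
  have "pairing f (\<lambda>z. complex_of_real (S (Suc n) z))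
      = pairing f (\<lambda>z. complex_of_real (\<phi> (snd z)) + complex_of_real (S n (shift z)))"
    by (simp add: S_Suc_shift)
  also have "\<dots> = pairing f (\<lambda>z. complex_of_real (\<phi> (snd z)))
      + pairing f (\<lambda>z. complex_of_real (S n (shift z)))"
    by (rule pairing_add_right[OF f bounded_fun_\<phi> bounded_fun_shift[OF bounded_fun_S]])
  also have "pairing f (\<lambda>z. complex_of_real (\<phi> (snd z))) = (LINT x|m. complex_of_real (\<phi> x) * f x)"
    using pairing_mult_left[of f "\<lambda>x. complex_of_real (\<phi> x)" "\<lambda>_. 1"] pairing_one[OF \<phi>_L1[OF f]]
    by simp
  also have "pairing f (\<lambda>z. complex_of_real (S n (shift z))) = pairing (P f) (\<lambda>z. complex_of_real (S n z))"
    by (rule pairing_shift[OF f bounded_fun_S])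
  finally show ?thesis .
qed

text \<open>The cross terms telescope: they contribute \<open>\<langle>v - P v, S\<^sub>n\<rangle>\<close>, a difference of first moments.\<close>

lemma second_moment:
  assumes v: "corrector v"
  shows "pairing h (\<lambda>z. complex_of_real ((S n z)^2))
    = of_nat n * green_kubo v - 2 * pairing v (\<lambda>z. complex_of_real (S n z))"
proof (induction n)
  case 0
  show ?case by (simp add: pairing_def)
next
  case (Suc n)
  let ?\<phi> = "\<lambda>x. complex_of_real (\<phi> x)" and ?S = "\<lambda>n z. complex_of_real (S n z)"
  have vL: "v \<in> L1 m" and veq: "AE x in m. v x - P v x = P (\<lambda>x. ?\<phi> x * h x) x"
    using v L1_mem by (auto simp: corrector_def)
  have bS: "bounded_fun (real n * b) (?S n)" by (rule bounded_fun_S)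
  have bS2: "bounded_fun (real n * b * (real n * b)) (\<lambda>z. ?S n z * ?S n z)"
    by (rule bounded_fun_mult[OF bS bS])
  have bp: "bounded_fun (b * b * 1) (\<lambda>z. (?\<phi> (snd z) * ?\<phi> (snd z)) * 1)"
    by (intro bounded_fun_mult bounded_fun_\<phi> bounded_fun_one)
  have bc: "bounded_fun (b * (real n * b)) (\<lambda>z. ?\<phi> (snd z) * ?S n (shift z))"
    by (intro bounded_fun_mult bounded_fun_\<phi> bounded_fun_shift[OF bS])
  have eq: "pairing h (\<lambda>z. complex_of_real ((S (Suc n) z)^2))
      = pairing h (\<lambda>z. (?\<phi> (snd z) * ?\<phi> (snd z)) * 1 + (?\<phi> (snd z) * ?S n (shift z)
          + (?\<phi> (snd z) * ?S n (shift z) + ?S n (shift z) * ?S n (shift z))))"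
    by (intro arg_cong[of _ _ "pairing h"] ext)
       (simp add: S_Suc_shift power2_eq_square algebra_simps)
  also have "\<dots> = pairing h (\<lambda>z. (?\<phi> (snd z) * ?\<phi> (snd z)) * 1)
      + (pairing h (\<lambda>z. ?\<phi> (snd z) * ?S n (shift z))
      + (pairing h (\<lambda>z. ?\<phi> (snd z) * ?S n (shift z))
      + pairing h (\<lambda>z. ?S n (shift z) * ?S n (shift z))))"
    using pairing_add_right[OF h_L1 bp bounded_fun_add[OF bc bounded_fun_add[OF bc bounded_fun_shift[OF bS2]]]]
      pairing_add_right[OF h_L1 bc bounded_fun_add[OF bc bounded_fun_shift[OF bS2]]]
      pairing_add_right[OF h_L1 bc bounded_fun_shift[OF bS2]] by (simp only:)
  also have "pairing h (\<lambda>z. (?\<phi> (snd z) * ?\<phi> (snd z)) * 1) = (LINT x|m. ?\<phi> x ^ 2 * h x)"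
    using pairing_mult_left[of h "\<lambda>x. ?\<phi> x * ?\<phi> x" "\<lambda>_. 1"] pairing_one[OF \<phi>2_L1[OF h_L1]]
    by (simp add: power2_eq_square)
  also have "pairing h (\<lambda>z. ?S n (shift z) * ?S n (shift z)) = pairing h (\<lambda>z. ?S n z * ?S n z)"
    using pairing_shift[OF h_L1 bS2] pairing_cong_AE[OF P_L1[OF h_L1] h_L1 P_h bS2] by simp
  also have "\<dots> = pairing h (\<lambda>z. complex_of_real ((S n z)^2))"
    by (simp add: power2_eq_square)
  also have "pairing h (\<lambda>z. ?\<phi> (snd z) * ?S n (shift z))
      = pairing v (?S n) - pairing v (?S (Suc n)) + (LINT x|m. ?\<phi> x * v x)"
  proof -
    have "pairing h (\<lambda>z. ?\<phi> (snd z) * ?S n (shift z)) = pairing (\<lambda>x. ?\<phi> x * h x) (\<lambda>z. ?S n (shift z))"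
      by (rule pairing_mult_left)
    also have "\<dots> = pairing (P (\<lambda>x. ?\<phi> x * h x)) (?S n)"
      by (rule pairing_shift[OF \<phi>_L1[OF h_L1] bS])
    also have "\<dots> = pairing (\<lambda>x. v x - P v x) (?S n)"
      using veq vL P_L1[OF vL]
      by (intro pairing_cong_AE[OF P_L1[OF \<phi>_L1[OF h_L1]] _ _ bS])
         (auto simp: L1_def elim!: eventually_mono)
    also have "\<dots> = pairing v (?S n) - pairing (P v) (?S n)"
      by (rule pairing_diff[OF vL P_L1[OF vL] bS])
    finally show ?thesis using first_moment_Suc[OF vL, of n] by simp
  qed
  finally show ?case unfolding Suc.IH by (simp add: green_kubo_def algebra_simps)
qed

text \<open>Solving the Poisson equation once more, now for \<open>v\<close>, makes the first moment telescope too.\<close>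

lemma first_moment_bounded:
  assumes v: "v \<in> B" and v0: "(LINT x|m. v x) = 0"
  obtains R where "\<And>n. cmod (pairing v (\<lambda>z. complex_of_real (S n z))) \<le> R"
proof -
  let ?S = "\<lambda>n z. complex_of_real (S n z)"
  obtain w where w: "w \<in> B" and weq: "AE x in m. w x - P w x = v x"
    by (rule poisson_equation_solvable[OF v v0])
  note wL = L1_mem[OF w] and vL = L1_mem[OF v]
  have "cmod (pairing v (?S n)) \<le> b * L1_norm m w + cmod (LINT x|m. complex_of_real (\<phi> x) * w x)" for n
  proof -
    have bS: "bounded_fun (real n * b) (?S n)" for n by (rule bounded_fun_S)
    have "pairing v (?S n) = pairing (\<lambda>x. w x - P w x) (?S n)"
      using weq wL vL P_L1[OF wL]
      by (intro pairing_cong_AE[OF _ _ _ bS]) (auto simp: L1_def elim!: eventually_mono)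
    also have "\<dots> = pairing w (?S n) - pairing (P w) (?S n)"
      by (rule pairing_diff[OF wL P_L1[OF wL] bS])
    also have "\<dots> = - (pairing w (?S (Suc n)) + pairing w (\<lambda>z. - 1 * ?S n z))
        + (LINT x|m. complex_of_real (\<phi> x) * w x)"
      using first_moment_Suc[OF wL, of n] by (simp only: pairing_scale_right) simp
    also have "pairing w (?S (Suc n)) + pairing w (\<lambda>z. - 1 * ?S n z)
        = pairing w (\<lambda>z. ?S (Suc n) z + - 1 * ?S n z)"
      using bounded_fun_mult[of 1 "\<lambda>_. - 1", OF _ bS]
      by (intro pairing_add_right[OF wL bS, symmetric]) (auto simp: bounded_fun_def)
    finally have eq: "pairing v (?S n) = - pairing w (\<lambda>z. ?S (Suc n) z + - 1 * ?S n z)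
        + (LINT x|m. complex_of_real (\<phi> x) * w x)" .
    have "bounded_fun b (\<lambda>z. ?S (Suc n) z + - 1 * ?S n z)"
      unfolding bounded_fun_def
    proof (intro conjI ballI)
      fix z assume "z \<in> space (Seq \<Otimes>\<^sub>M m)"
      from S_Suc_diff_bound[OF this, of n] show "cmod (?S (Suc n) z + - 1 * ?S n z) \<le> b"
        by (metis mult_minus1 norm_of_real of_real_diff uminus_add_conv_diff add.commute)
    qed measurable
    from pairing_bound[OF wL this] show ?thesis
      unfolding eq by (intro norm_triangle_ineq[THEN order_trans]) simp
  qed
  then show thesis by (rule that)
qed

lemma second_moment_limit:
  assumes v: "corrector v"
  shows "(\<lambda>n. complex_of_real (1 / real n) * pairing h (\<lambda>z. complex_of_real ((S n z)^2)))
    \<longlonglongrightarrow> green_kubo v"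
proof -
  let ?p = "\<lambda>n. pairing v (\<lambda>z. complex_of_real (S n z))"
  obtain R where R: "\<And>n. cmod (?p n) \<le> R"
    using first_moment_bounded v unfolding corrector_def by metis
  have "(\<lambda>n. complex_of_real (1 / real n) * ?p n) \<longlonglongrightarrow> 0"
  proof (rule Lim_null_comparison)
    show "\<forall>\<^sub>F n in sequentially. norm (complex_of_real (1 / real n) * ?p n) \<le> R / real n"
      using R by (auto simp: norm_mult norm_divide divide_right_mono)
    show "(\<lambda>n. R / real n) \<longlonglongrightarrow> 0" by (rule lim_const_over_n)
  qed
  then have "(\<lambda>n. green_kubo v - 2 * (complex_of_real (1 / real n) * ?p n)) \<longlonglongrightarrow> green_kubo v - 2 * 0"
    by (intro tendsto_intros)
  moreover have "\<forall>\<^sub>F n in sequentially. green_kubo v - 2 * (complex_of_real (1 / real n) * ?p n)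
      = complex_of_real (1 / real n) * pairing h (\<lambda>z. complex_of_real ((S n z)^2))"
    using eventually_gt_at_top[of "0::nat"]
  proof eventually_elim
    case (elim n)
    then show ?case unfolding second_moment[OF v] by (simp add: field_simps)
  qed
  ultimately have "(\<lambda>n. complex_of_real (1 / real n) * pairing h (\<lambda>z. complex_of_real ((S n z)^2)))
    \<longlonglongrightarrow> green_kubo v - 2 * 0"
    by (rule Lim_transform_eventually)
  then show ?thesis by (simp only: mult_zero_right diff_zero)
qed

end

section \<open>Perturbed eigenvectors and the characteristic function\<close>

text \<open>
  The bracket that is subtracted is the product \<open>exp (\<i>ty) (a0 + \<i>t a1 + (\<i>t)\<^sup>2 a2)\<close> with the terms
  of order \<open>t\<^sup>3\<close> and higher dropped.
\<close>

lemma iexp_perturbation: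
  fixes t y b :: real and a0 a1 a2 :: complex
  assumes y: "\<bar>y\<bar> \<le> b"
  shows "cmod (iexp (t * y) * (a0 + \<i> * t * a1 + (\<i> * t)^2 * a2)
      - (a0 + \<i> * t * (a1 + y * a0) + (\<i> * t)^2 * (a2 + (y * a1 + complex_of_real y ^ 2 / 2 * a0))))
    \<le> \<bar>t\<bar>^3 * ((b^3 + b^2 + b) * (cmod a0 + cmod a1 + cmod a2))"
proof -
  \<comment> \<open>The remainder of \<open>exp\<close> of order three multiplies \<open>a0\<close>, that of order two \<open>\<i>t a1\<close>, and that of
    order one \<open>(\<i>t)\<^sup>2 a2\<close>, so that each product has order three.\<close>
  define e where "e = iexp (t * y)"
  define \<tau> where "\<tau> = \<i> * complex_of_real t"
  have b: "0 \<le> b" using y by simp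
  have \<tau>n: "cmod \<tau> = \<bar>t\<bar>" by (simp add: \<tau>_def norm_mult)
  have ty: "\<bar>t * y\<bar> \<le> \<bar>t\<bar> * b" using y by (simp add: abs_mult mult_left_mono)
  have p: "\<bar>t * y\<bar>^k \<le> \<bar>t\<bar>^k * b^k" for k
    using power_mono[OF ty abs_ge_zero, of k] by (simp add: power_mult_distrib)
  have r1: "cmod (e - 1) \<le> \<bar>t\<bar> * b"
    using iexp_approx1[of "t * y" 0] ty by (simp add: e_def)
  have r2: "cmod (e - (1 + \<tau> * y)) \<le> \<bar>t\<bar>^2 * b^2"
  proof -
    have "cmod (e - (1 + \<tau> * y)) \<le> \<bar>t * y\<bar>^2 / 2"
      using iexp_approx1[of "t * y" 1] by (simp add: e_def \<tau>_def mult.assoc numeral_2_eq_2)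
    then show ?thesis using p[of 2] zero_le_power[OF abs_ge_zero, of "t * y" 2] by linarith
  qed
  have r3: "cmod (e - (1 + \<tau> * y + (\<tau> * y)^2 / 2)) \<le> \<bar>t\<bar>^3 * b^3"
  proof -
    have "cmod (e - (1 + \<tau> * y + (\<tau> * y)^2 / 2)) \<le> \<bar>t * y\<bar>^3 / 6"
      using iexp_approx1[of "t * y" 2]
      by (simp add: e_def \<tau>_def mult.assoc numeral_2_eq_2 numeral_3_eq_3)
    then show ?thesis using p[of 3] zero_le_power[OF abs_ge_zero, of "t * y" 3] by linarith
  qed
  have "e * (a0 + \<tau> * a1 + \<tau>^2 * a2)
      - (a0 + \<tau> * (a1 + y * a0) + \<tau>^2 * (a2 + (y * a1 + complex_of_real y ^ 2 / 2 * a0)))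
    = (e - (1 + \<tau> * y + (\<tau> * y)^2 / 2)) * a0 + \<tau> * (e - (1 + \<tau> * y)) * a1 + \<tau>^2 * (e - 1) * a2"
    by (simp add: field_simps power2_eq_square)
  also have "cmod \<dots> \<le> \<bar>t\<bar>^3 * b^3 * cmod a0 + \<bar>t\<bar> * (\<bar>t\<bar>^2 * b^2) * cmod a1
      + \<bar>t\<bar>^2 * (\<bar>t\<bar> * b) * cmod a2"
    by (intro norm_triangle_mono) (auto simp: norm_mult norm_power \<tau>n intro!: mult_right_mono mult_left_mono r1 r2[simplified] r3)
  also have "\<dots> = \<bar>t\<bar>^3 * (b^3 * cmod a0 + b^2 * cmod a1 + b * cmod a2)"
    by (simp add: algebra_simps power2_eq_square power3_eq_cube)
  also have "\<dots> \<le> \<bar>t\<bar>^3 * ((b^3 + b^2 + b) * (cmod a0 + cmod a1 + cmod a2))"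
    using b by (intro mult_left_mono) (simp_all add: algebra_simps)
  finally show ?thesis by (simp add: e_def \<tau>_def)
qed

lemma cmod_iexp_diff_le: "cmod (iexp x - iexp y) \<le> \<bar>x - y\<bar>"
proof -
  have "iexp x - iexp y = iexp y * (iexp (x - y) - 1)"
    by (simp add: exp_diff right_diff_distrib field_simps)
  then have "cmod (iexp x - iexp y) = cmod (iexp (x - y) - 1)"
    by (simp add: norm_mult)
  then show ?thesis using iexp_approx1[of "x - y" 0] by simp
qed

text \<open>Errors of single steps do not grow, as they are propagated by powers of \<open>l\<close>.\<close>

lemma perturbed_recursion_bound:
  fixes a :: "nat \<Rightarrow> complex"
  assumes l: "cmod l \<le> 1" and step: "\<And>n. cmod (a (Suc n) - l * a n) \<le> e"
  shows "cmod (a n - l ^ n * a 0) \<le> real n * e"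
proof (induction n)
  case (Suc n)
  have "a (Suc n) - l ^ Suc n * a 0 = (a (Suc n) - l * a n) + l * (a n - l ^ n * a 0)"
    by (simp add: algebra_simps)
  also have "cmod \<dots> \<le> e + 1 * (real n * e)"
    unfolding norm_mult
    by (intro norm_triangle_mono step) (unfold norm_mult, intro mult_mono l Suc, auto)
  finally show ?case by (simp add: algebra_simps)
qed simp

context annealed_clt
begin

abbreviation E :: "nat \<Rightarrow> real \<Rightarrow> (nat \<Rightarrow> 'w) \<times> 'x \<Rightarrow> complex" where
  "E n t \<equiv> (\<lambda>z. iexp (t * S n z))"

lemma bounded_fun_E: "bounded_fun 1 (E n t)"
  unfolding bounded_fun_def by simp

text \<open>
  The right-hand side has mean zero exactly when \<open>s\<close> is the Green--Kubo value, which is how the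
  variance is forced on the second-order term.
\<close>
definition second_corrector :: "('x \<Rightarrow> complex) \<Rightarrow> real \<Rightarrow> ('x \<Rightarrow> complex) \<Rightarrow> bool" where
  "second_corrector v s v2 \<longleftrightarrow> v2 \<in> B \<and> (LINT x|m. v2 x) = 0 \<and>
     (AE x in m. v2 x - P v2 x =
        P (\<lambda>x. complex_of_real (\<phi> x) * v x + complex_of_real (\<phi> x)^2 / 2 * h x) x - of_real (s / 2) * h x)"

lemma half_\<phi>2_mult: "f \<in> B \<Longrightarrow> (\<lambda>x. complex_of_real (\<phi> x)^2 / 2 * f x) \<in> B"
  using scale_mem[OF \<phi>2_mult, of f "1 / 2"] by simp

lemma second_corrector_exists:
  assumes v: "corrector v" and s: "green_kubo v = complex_of_real s"
  obtains v2 where "second_corrector v s v2"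
proof -
  let ?\<phi> = "\<lambda>x. complex_of_real (\<phi> x)"
  let ?k = "\<lambda>x. ?\<phi> x * v x + ?\<phi> x ^ 2 / 2 * h x"
  have vB: "v \<in> B" using v by (simp add: corrector_def)
  have kB: "?k \<in> B" by (intro add_mem \<phi>_mult half_\<phi>2_mult vB h_mem)
  have dB: "(\<lambda>x. P ?k x - of_real (s / 2) * h x) \<in> B"
    by (intro diff_mem P_mem scale_mem kB h_mem)
  have "(LINT x|m. P ?k x - of_real (s / 2) * h x) = (LINT x|m. P ?k x) - of_real (s / 2) * (LINT x|m. h x)"
    using L1_mem[OF P_mem[OF kB]] h_L1 by (simp add: L1_def)
  also have "(LINT x|m. P ?k x) = (LINT x|m. ?k x)" by (rule integral_P[OF L1_mem[OF kB]])
  also have "\<dots> = (LINT x|m. ?\<phi> x * v x) + (LINT x|m. ?\<phi> x ^ 2 / 2 * h x)"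
    using L1_mem[OF \<phi>_mult[OF vB]] L1_mem[OF half_\<phi>2_mult[OF h_mem]] by (simp add: L1_def)
  also have "(LINT x|m. ?\<phi> x ^ 2 / 2 * h x) = (LINT x|m. ?\<phi> x ^ 2 * h x) / 2" by simp
  finally have int: "(LINT x|m. P ?k x - of_real (s / 2) * h x)
    = (LINT x|m. ?\<phi> x * v x) + (LINT x|m. ?\<phi> x ^ 2 * h x) / 2 - of_real (s / 2) * (LINT x|m. h x)" .
  have half: "complex_of_real (s / 2)
      = ((LINT x|m. ?\<phi> x ^ 2 * h x) + 2 * (LINT x|m. ?\<phi> x * v x)) / 2"
    using s by (simp add: green_kubo_def)
  have "(LINT x|m. P ?k x - of_real (s / 2) * h x) = 0"
    by (subst int, subst half, subst integral_h) (simp add: add_divide_distrib)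
  then obtain v2 where "v2 \<in> B" "(LINT x|m. v2 x) = 0"
    "AE x in m. v2 x - P v2 x = P ?k x - of_real (s / 2) * h x"
    by (rule poisson_equation_solvable[OF dB])
  then show thesis by (intro that[of v2]) (simp add: second_corrector_def)
qed

text \<open>
  The function \<open>u = h + \<i>t v + (\<i>t)\<^sup>2 v2\<close> is an eigenvector of the perturbed operator
  \<open>f \<mapsto> P (exp (\<i>t\<phi>) f)\<close> up to an error of order \<open>t\<^sup>3\<close> in \<open>L\<^sup>1\<close>, with eigenvalue \<open>1 - s t\<^sup>2 / 2\<close>:
  the two corrector equations are what cancels the terms of order \<open>t\<close> and \<open>t\<^sup>2\<close>.
\<close>

lemma approximate_eigenvector:
  assumes v: "corrector v" and v2: "second_corrector v s v2"
  defines "u \<equiv> \<lambda>t x. h x + \<i> * complex_of_real t * v x + (\<i> * complex_of_real t)^2 * v2 x"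
  obtains Q where "\<And>n t. \<bar>t\<bar> \<le> 1 \<Longrightarrow>
    cmod (pairing (u t) (E (Suc n) t) - of_real (1 - s * t^2 / 2) * pairing (u t) (E n t)) \<le> Q * \<bar>t\<bar>^3"
proof -
  let ?\<phi> = "\<lambda>x. complex_of_real (\<phi> x)"
  let ?k = "\<lambda>x. ?\<phi> x * v x + ?\<phi> x ^ 2 / 2 * h x"
  have vB: "v \<in> B" and veq: "AE x in m. v x - P v x = P (\<lambda>x. ?\<phi> x * h x) x"
    using v by (auto simp: corrector_def)
  have v2B: "v2 \<in> B" and v2eq: "AE x in m. v2 x - P v2 x = P ?k x - of_real (s / 2) * h x"
    using v2 by (auto simp: second_corrector_def)
  have kB: "?k \<in> B" by (intro add_mem \<phi>_mult half_\<phi>2_mult vB h_mem)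
  have phB: "(\<lambda>x. ?\<phi> x * h x) \<in> B" by (intro \<phi>_mult h_mem)
  \<comment> \<open>The coefficients of \<open>\<i>t\<close> and \<open>(\<i>t)\<^sup>2\<close> in \<open>exp (\<i>t\<phi>) u\<close>.\<close>
  define k1 where "k1 = (\<lambda>x. v x + ?\<phi> x * h x)"
  define k2 where "k2 = (\<lambda>x. v2 x + ?k x)"
  have k1B: "k1 \<in> B" and k2B: "k2 \<in> B"
    unfolding k1_def k2_def by (intro add_mem vB phB v2B kB)+
  have Pk1: "AE x in m. P k1 x = v x"
    using P_lincomb[OF L1_mem[OF vB] L1_mem[OF phB], of 1 1] veq
    by eventually_elim (simp add: k1_def algebra_simps)
  have Pk2: "AE x in m. P k2 x = v2 x - of_real (s / 2) * h x + of_real (s / 2) * (2 * h x)"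
    using P_lincomb[OF L1_mem[OF v2B] L1_mem[OF kB], of 1 1] v2eq
    by eventually_elim (simp add: k2_def algebra_simps)
  then have Pk2: "AE x in m. P k2 x = 1 * v2 x + of_real (s / 2) * h x"
    by eventually_elim (simp add: algebra_simps)
  let ?V = "L1_norm m h + L1_norm m v + L1_norm m v2"
  have Vnn: "0 \<le> L1_norm m f" for f unfolding L1_norm_def by simp
  define Q where "Q = (b^3 + b^2 + b) * ?V + \<bar>s\<bar> * (L1_norm m v + L1_norm m v2)"
  have "cmod (pairing (u t) (E (Suc n) t) - of_real (1 - s * t^2 / 2) * pairing (u t) (E n t)) \<le> Q * \<bar>t\<bar>^3"
    if t1: "\<bar>t\<bar> \<le> 1" for n t
  proof -
    define \<tau> where "\<tau> = \<i> * complex_of_real t"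
    have \<tau>2: "\<tau>^2 = - complex_of_real (t^2)" by (simp add: \<tau>_def power_mult_distrib)
    have \<tau>n: "cmod \<tau> = \<bar>t\<bar>" by (simp add: \<tau>_def norm_mult)
    let ?G = "E n t" and ?G' = "\<lambda>z. E n t (shift z)"
    let ?J = "\<lambda>f. pairing f ?G"
    have bG: "bounded_fun 1 ?G" by (rule bounded_fun_E)
    note bG' = bounded_fun_shift[OF bG]
    \<comment> \<open>The expansion of \<open>exp (\<i>t\<phi>) u\<close> to second order.\<close>
    define a where "a = (\<lambda>x. 1 * (1 * h x + \<tau> * k1 x) + \<tau>^2 * k2 x)"
    have aB: "a \<in> B" unfolding a_def by (intro lincomb_mem h_mem k1B k2B)
    have u_eq: "u t = (\<lambda>x. 1 * (1 * h x + \<tau> * v x) + \<tau>^2 * v2 x)"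
      by (simp add: u_def \<tau>_def)
    have uB: "u t \<in> B" unfolding u_eq by (intro lincomb_mem h_mem vB v2B)
    have Ju: "?J (u t) = ?J h + \<tau> * ?J v + \<tau>^2 * ?J v2"
      unfolding u_eq
      by (subst pairing_lincomb[OF L1_mem L1_mem bG] , intro lincomb_mem h_mem vB v2B, rule v2B,
          subst pairing_lincomb[OF L1_mem L1_mem bG], rule h_mem, rule vB) simp
    have "pairing k1 ?G' = ?J (P k1)" by (rule pairing_shift[OF L1_mem[OF k1B] bG])
    also have "\<dots> = ?J v"
      by (rule pairing_cong_AE[OF L1_mem[OF P_mem[OF k1B]] L1_mem[OF vB] Pk1 bG])
    finally have J1: "pairing k1 ?G' = ?J v" .
    have "pairing k2 ?G' = ?J (P k2)" by (rule pairing_shift[OF L1_mem[OF k2B] bG])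
    also have "\<dots> = ?J (\<lambda>x. 1 * v2 x + of_real (s / 2) * h x)"
      by (rule pairing_cong_AE[OF L1_mem[OF P_mem[OF k2B]] L1_mem[OF lincomb_mem[OF v2B h_mem]] Pk2 bG])
    also have "\<dots> = ?J v2 + of_real (s / 2) * ?J h"
      by (subst pairing_lincomb[OF L1_mem[OF v2B] h_L1 bG]) simp
    finally have J2: "pairing k2 ?G' = ?J v2 + of_real (s / 2) * ?J h" .
    have "pairing h ?G' = ?J (P h)" by (rule pairing_shift[OF h_L1 bG])
    also have "\<dots> = ?J h" by (rule pairing_cong_AE[OF P_L1[OF h_L1] h_L1 P_h bG])
    finally have J0: "pairing h ?G' = ?J h" .
    have "pairing a ?G' = pairing h ?G' + \<tau> * pairing k1 ?G' + \<tau>^2 * pairing k2 ?G'"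
      unfolding a_def
      by (subst pairing_lincomb[OF L1_mem L1_mem bG'] , intro lincomb_mem h_mem k1B k2B, rule k2B,
          subst pairing_lincomb[OF L1_mem L1_mem bG'], rule h_mem, rule k1B) simp
    then have Ja: "pairing a ?G' = ?J h + \<tau> * ?J v + \<tau>^2 * (?J v2 + of_real (s / 2) * ?J h)"
      unfolding J0 J1 J2 .
    let ?e = "\<lambda>x. iexp (t * \<phi> x)"
    have eL: "(\<lambda>x. ?e x * u t x) \<in> L1 m"
      unfolding L1_def mem_Collect_eq
    proof (rule Bochner_Integration.integrable_bound)
      show "integrable m (u t)" using L1_mem[OF uB] by (simp add: L1_def)
      show "(\<lambda>x. ?e x * u t x) \<in> borel_measurable m"
        using L1_measurable[OF L1_mem[OF uB]] by measurable
    qed (simp add: norm_mult)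
    have "pairing (u t) (E (Suc n) t) = pairing (u t) (\<lambda>z. ?e (snd z) * ?G' z)"
      by (intro arg_cong[of _ _ "pairing (u t)"] ext)
         (simp add: S_Suc_shift exp_add[symmetric] algebra_simps)
    also have "\<dots> = pairing (\<lambda>x. ?e x * u t x) ?G'" by (rule pairing_mult_left)
    finally have Je: "pairing (u t) (E (Suc n) t) = pairing (\<lambda>x. ?e x * u t x) ?G'" .
    have "cmod (pairing (\<lambda>x. ?e x * u t x) ?G' - pairing a ?G')
        = cmod (pairing (\<lambda>x. ?e x * u t x - a x) ?G')"
      by (simp only: pairing_diff[OF eL L1_mem[OF aB] bG'])
    also have "\<dots> \<le> 1 * L1_norm m (\<lambda>x. ?e x * u t x - a x)"
      using eL L1_mem[OF aB] by (intro pairing_bound bG') (auto simp: L1_def)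
    also have "\<dots> \<le> (LINT x|m. \<bar>t\<bar>^3 * ((b^3 + b^2 + b) * (cmod (h x) + cmod (v x) + cmod (v2 x))))"
      unfolding L1_norm_def mult_1
    proof (rule integral_mono)
      show "integrable m (\<lambda>x. cmod (?e x * u t x - a x))"
        using eL L1_mem[OF aB] by (auto simp: L1_def)
      show "integrable m (\<lambda>x. \<bar>t\<bar>^3 * ((b^3 + b^2 + b) * (cmod (h x) + cmod (v x) + cmod (v2 x))))"
        using h_L1 L1_mem[OF vB] L1_mem[OF v2B] by (auto simp: L1_def)
      fix x assume "x \<in> space m"
      from iexp_perturbation[OF \<phi>_bound[OF this], of t "h x" "v x" "v2 x"]
      show "cmod (?e x * u t x - a x) \<le> \<bar>t\<bar>^3 * ((b^3 + b^2 + b) * (cmod (h x) + cmod (v x) + cmod (v2 x)))"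
        by (simp add: u_def a_def k1_def k2_def \<tau>_def)
    qed
    also have "\<dots> = \<bar>t\<bar>^3 * ((b^3 + b^2 + b) * ?V)"
      using h_L1 L1_mem[OF vB] L1_mem[OF v2B] by (simp add: L1_norm_def L1_def)
    finally have err1: "cmod (pairing (\<lambda>x. ?e x * u t x) ?G' - pairing a ?G')
        \<le> \<bar>t\<bar>^3 * ((b^3 + b^2 + b) * ?V)" .
    have Jb: "cmod (?J f) \<le> L1_norm m f" if "f \<in> B" for f
      using pairing_bound[OF L1_mem[OF that] bG] by simp
    have "pairing a ?G' - of_real (1 - s * t^2 / 2) * ?J (u t)
        = of_real (s * t^2 / 2) * (\<tau> * (?J v + \<tau> * ?J v2))"
    proof -
      have ring: "X + \<tau> * Y + \<tau>^2 * (Z + r * X) - (1 + r * \<tau>^2) * (X + \<tau> * Y + \<tau>^2 * Z)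
          = - (r * \<tau>^2) * (\<tau> * (Y + \<tau> * Z))" for X Y Z r
        by (simp add: algebra_simps power2_eq_square)
      have "complex_of_real (1 - s * t^2 / 2) = 1 + of_real (s / 2) * \<tau>^2"
        "complex_of_real (s * t^2 / 2) = - (of_real (s / 2) * \<tau>^2)" by (simp_all add: \<tau>2)
      then show ?thesis unfolding Ja Ju by (simp only: ring)
    qed
    also have "cmod \<dots> = \<bar>s\<bar> * t^2 / 2 * (\<bar>t\<bar> * cmod (?J v + \<tau> * ?J v2))"
      by (simp add: norm_mult \<tau>n norm_divide norm_power)
    also have "\<dots> \<le> \<bar>s\<bar> * t^2 / 2 * (\<bar>t\<bar> * (L1_norm m v + 1 * L1_norm m v2))"
    proof -
      have "cmod (?J v + \<tau> * ?J v2) \<le> L1_norm m v + 1 * L1_norm m v2"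
        by (rule norm_triangle_mono[OF Jb[OF vB]])
           (unfold norm_mult \<tau>n, intro mult_mono t1 Jb v2B, auto)
      then show ?thesis by (intro mult_left_mono) auto
    qed
    also have "\<dots> = \<bar>t\<bar>^3 * (\<bar>s\<bar> * (L1_norm m v + L1_norm m v2)) / 2"
      by (simp add: power2_eq_square power3_eq_cube abs_mult_self_eq algebra_simps)
    also have "\<dots> \<le> \<bar>t\<bar>^3 * (\<bar>s\<bar> * (L1_norm m v + L1_norm m v2))"
      using Vnn[of v] Vnn[of v2] by (simp add: mult_nonneg_nonneg)
    finally have err2: "cmod (pairing a ?G' - of_real (1 - s * t^2 / 2) * ?J (u t))
        \<le> \<bar>t\<bar>^3 * (\<bar>s\<bar> * (L1_norm m v + L1_norm m v2))" .
    have "cmod (pairing (u t) (E (Suc n) t) - of_real (1 - s * t^2 / 2) * ?J (u t))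
        = cmod ((pairing (\<lambda>x. ?e x * u t x) ?G' - pairing a ?G')
            + (pairing a ?G' - of_real (1 - s * t^2 / 2) * ?J (u t)))"
      unfolding Je by simp
    also have "\<dots> \<le> \<bar>t\<bar>^3 * ((b^3 + b^2 + b) * ?V) + \<bar>t\<bar>^3 * (\<bar>s\<bar> * (L1_norm m v + L1_norm m v2))"
      by (rule norm_triangle_mono[OF err1 err2])
    also have "\<dots> = Q * \<bar>t\<bar>^3" by (simp add: Q_def algebra_simps)
    finally show ?thesis .
  qed
  then show thesis by (rule that)
qed

text \<open>
  At \<open>\<theta> = t / sqrt n\<close> the \<open>n\<close> errors of order \<open>\<theta>\<^sup>3\<close> add up to order \<open>1 / sqrt n\<close>, and the
  \<open>n\<close>-th power of the approximate eigenvalue is \<open>(1 - s t\<^sup>2 / (2 n))\<^sup>n\<close>.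
\<close>

lemma characteristic_function_invariant:
  assumes v: "corrector v" and gk: "green_kubo v = complex_of_real s" and s0: "0 \<le> s"
  shows "(\<lambda>n. pairing h (E n (t / sqrt (real n)))) \<longlonglongrightarrow> complex_of_real (exp (- (s * t^2 / 2)))"
proof -
  obtain v2 where v2: "second_corrector v s v2" by (rule second_corrector_exists[OF v gk])
  define u where "u \<theta> x = h x + \<i> * complex_of_real \<theta> * v x + (\<i> * complex_of_real \<theta>)^2 * v2 x" for \<theta> x
  obtain Q where Q: "\<And>n \<theta>. \<bar>\<theta>\<bar> \<le> 1 \<Longrightarrow> cmod (pairing (u \<theta>) (E (Suc n) \<theta>)
      - of_real (1 - s * \<theta>^2 / 2) * pairing (u \<theta>) (E n \<theta>)) \<le> Q * \<bar>\<theta>\<bar>^3"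
    using approximate_eigenvector[OF v v2] unfolding u_def by blast
  have vB: "v \<in> B" and v0: "(LINT x|m. v x) = 0" and v2B: "v2 \<in> B" and v20: "(LINT x|m. v2 x) = 0"
    using v v2 by (auto simp: corrector_def second_corrector_def)
  have u_eq: "u \<theta> = (\<lambda>x. 1 * (1 * h x + \<i> * complex_of_real \<theta> * v x) + (\<i> * complex_of_real \<theta>)^2 * v2 x)"
    for \<theta> by (rule ext) (simp add: u_def)
  have uB: "u \<theta> \<in> B" for \<theta> unfolding u_eq by (intro lincomb_mem h_mem vB v2B)
  have Ju: "pairing (u \<theta>) (E n \<theta>) = pairing h (E n \<theta>)
      + \<i> * complex_of_real \<theta> * (pairing v (E n \<theta>) + \<i> * complex_of_real \<theta> * pairing v2 (E n \<theta>))" for n \<theta>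
    unfolding u_eq
    by (subst pairing_lincomb[OF L1_mem L1_mem bounded_fun_E] , intro lincomb_mem h_mem vB v2B, rule v2B,
        subst pairing_lincomb[OF L1_mem L1_mem bounded_fun_E], rule h_mem, rule vB)
       (simp add: algebra_simps power2_eq_square)
  have u1: "pairing (u \<theta>) (E 0 \<theta>) = 1" for \<theta>
  proof -
    have "pairing f (E 0 \<theta>) = (LINT x|m. f x)" if "f \<in> B" for f
      using pairing_one[OF L1_mem[OF that]] by simp
    then show ?thesis unfolding Ju using h_mem vB v2B v0 v20 integral_h by simp
  qed
  define V where "V = L1_norm m v + L1_norm m v2"
  have Jb: "cmod (pairing f (E n \<theta>)) \<le> L1_norm m f" if "f \<in> B" for f n \<theta>
    using pairing_bound[OF L1_mem[OF that] bounded_fun_E] by simp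
  have V0: "0 \<le> V" unfolding V_def L1_norm_def by simp
  have main: "cmod (pairing h (E n \<theta>) - of_real (1 - s * \<theta>^2 / 2) ^ n) \<le> real n * (Q * \<bar>\<theta>\<bar>^3) + \<bar>\<theta>\<bar> * V"
    if \<theta>: "\<bar>\<theta>\<bar> \<le> 1" and small: "s * \<theta>^2 / 2 \<le> 1" for n \<theta>
  proof -
    let ?l = "complex_of_real (1 - s * \<theta>^2 / 2)" and ?\<tau> = "\<i> * complex_of_real \<theta>"
    have "0 \<le> s * \<theta>^2 / 2" using s0 by simp
    then have l: "cmod ?l \<le> 1" using small unfolding norm_of_real by linarith
    have 1: "cmod (pairing (u \<theta>) (E n \<theta>) - ?l ^ n * pairing (u \<theta>) (E 0 \<theta>)) \<le> real n * (Q * \<bar>\<theta>\<bar>^3)"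
      using perturbed_recursion_bound[of ?l "\<lambda>n. pairing (u \<theta>) (E n \<theta>)", OF l Q[OF \<theta>]] .
    have "cmod (?\<tau> * (pairing v (E n \<theta>) + ?\<tau> * pairing v2 (E n \<theta>))) \<le> \<bar>\<theta>\<bar> * V"
    proof -
      have "cmod (pairing v (E n \<theta>) + ?\<tau> * pairing v2 (E n \<theta>)) \<le> L1_norm m v + 1 * L1_norm m v2"
        by (rule norm_triangle_mono[OF Jb[OF vB]])
           (unfold norm_mult, intro mult_mono Jb v2B, use \<theta> in auto)
      then show ?thesis by (simp add: norm_mult V_def mult_left_mono)
    qed
    moreover have "pairing h (E n \<theta>) - ?l ^ n = (pairing (u \<theta>) (E n \<theta>) - ?l ^ n * pairing (u \<theta>) (E 0 \<theta>))
        - ?\<tau> * (pairing v (E n \<theta>) + ?\<tau> * pairing v2 (E n \<theta>))"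
      unfolding u1 by (subst Ju) simp
    ultimately show ?thesis using 1 by (smt (verit) norm_triangle_ineq4)
  qed
  define \<theta> where "\<theta> n = t / sqrt (real n)" for n :: nat
  have \<theta>0: "\<theta> \<longlonglongrightarrow> 0"
    unfolding \<theta>_def
    by (rule tendsto_divide_0[OF tendsto_const])
       (rule filterlim_at_top_imp_at_infinity[OF filterlim_compose[OF sqrt_at_top filterlim_real_sequentially]])
  have \<theta>sq: "(\<theta> n)^2 = t^2 / real n" for n by (simp add: \<theta>_def power_divide)
  have "(\<lambda>n. (1 + (- (s * t^2 / 2)) / real n) ^ n) \<longlonglongrightarrow> exp (- (s * t^2 / 2))"
    by (rule tendsto_exp_limit_sequentially)
  then have pow: "(\<lambda>n. complex_of_real (1 - s * (\<theta> n)^2 / 2) ^ n) \<longlonglongrightarrow> complex_of_real (exp (- (s * t^2 / 2)))"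
    by (subst of_real_power[symmetric], intro tendsto_of_real) (simp add: \<theta>sq mult.commute)
  have ev1: "\<forall>\<^sub>F n in sequentially. \<bar>\<theta> n\<bar> \<le> 1"
    using tendstoD[OF \<theta>0, of 1] by (auto elim!: eventually_mono)
  have "(\<lambda>n. s * (\<theta> n)^2 / 2) \<longlonglongrightarrow> s * 0^2 / 2" by (intro tendsto_intros \<theta>0) simp
  then have "\<forall>\<^sub>F n in sequentially. s * (\<theta> n)^2 / 2 < 1" by (rule order_tendstoD(2)) simp
  then have ev2: "\<forall>\<^sub>F n in sequentially. s * (\<theta> n)^2 / 2 \<le> 1"
    by (rule eventually_mono) simp
  have "(\<lambda>n. pairing h (E n (\<theta> n)) - complex_of_real (1 - s * (\<theta> n)^2 / 2) ^ n) \<longlonglongrightarrow> 0"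
  proof (rule Lim_null_comparison)
    show "\<forall>\<^sub>F n in sequentially. norm (pairing h (E n (\<theta> n)) - complex_of_real (1 - s * (\<theta> n)^2 / 2) ^ n)
        \<le> Q * t^2 * \<bar>\<theta> n\<bar> + \<bar>\<theta> n\<bar> * V"
      using ev1 ev2 eventually_gt_at_top[of "0::nat"]
    proof eventually_elim
      case (elim n)
      have "real n * (Q * \<bar>\<theta> n\<bar>^3) = Q * (real n * (\<theta> n)^2) * \<bar>\<theta> n\<bar>"
        by (simp add: power3_eq_cube power2_eq_square abs_mult_self_eq algebra_simps)
      also have "real n * (\<theta> n)^2 = t^2" using elim by (simp add: \<theta>sq)
      finally have eq: "real n * (Q * \<bar>\<theta> n\<bar>^3) = Q * t^2 * \<bar>\<theta> n\<bar>" .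
      show ?case using main[OF elim(1,2), of n] unfolding eq .
    qed
    have "(\<lambda>n. Q * t^2 * \<bar>\<theta> n\<bar> + \<bar>\<theta> n\<bar> * V) \<longlonglongrightarrow> Q * t^2 * \<bar>0\<bar> + \<bar>0\<bar> * V"
      by (intro tendsto_intros \<theta>0)
    then show "(\<lambda>n. Q * t^2 * \<bar>\<theta> n\<bar> + \<bar>\<theta> n\<bar> * V) \<longlonglongrightarrow> 0" by simp
  qed
  from tendsto_add[OF this pow] show ?thesis by (simp add: \<theta>_def)
qed

text \<open>
  Two initial densities differ by some \<open>w - P w\<close>, and replacing \<open>w\<close> by \<open>P w\<close> only shifts the
  orbit by one step, which changes \<open>t S\<^sub>n\<close> by at most \<open>2 b t\<close>.  Hence the limit law does not
  depend on the initial density.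
\<close>

lemma characteristic_function_limit:
  assumes v: "corrector v" and gk: "green_kubo v = complex_of_real s" and s0: "0 \<le> s"
    and f: "f \<in> B" and f1: "(LINT x|m. f x) = 1"
  shows "(\<lambda>n. pairing f (E n (t / sqrt (real n)))) \<longlonglongrightarrow> complex_of_real (exp (- (s * t^2 / 2)))"
proof -
  have fL: "f \<in> L1 m" by (rule L1_mem[OF f])
  have "(LINT x|m. f x - h x) = 0" using fL h_L1 f1 integral_h by (simp add: L1_def)
  then obtain w where w: "w \<in> B" and weq: "AE x in m. w x - P w x = f x - h x"
    using poisson_equation_solvable[OF diff_mem[OF f h_mem]] by metis
  have wL: "w \<in> L1 m" by (rule L1_mem[OF w])
  have diff: "cmod (pairing f (E n \<theta>) - pairing h (E n \<theta>)) \<le> \<bar>\<theta>\<bar> * (2 * b) * L1_norm m w" for n \<theta>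
  proof -
    let ?G = "E n \<theta>" and ?G' = "\<lambda>z. E n \<theta> (shift z)"
    have bG: "bounded_fun 1 ?G" by (rule bounded_fun_E)
    have bG': "bounded_fun 1 (\<lambda>z. - 1 * ?G' z)"
      using bounded_fun_shift[OF bG] by (auto simp: bounded_fun_def)
    have "pairing f ?G - pairing h ?G = pairing (\<lambda>x. f x - h x) ?G"
      by (rule pairing_diff[OF fL h_L1 bG, symmetric])
    also have "\<dots> = pairing (\<lambda>x. w x - P w x) ?G"
      using weq by (intro pairing_cong_AE[OF _ _ _ bG] L1_mem diff_mem P_mem f h_mem w)
        (auto elim!: eventually_mono)
    also have "\<dots> = pairing w ?G - pairing (P w) ?G"
      by (rule pairing_diff[OF wL P_L1[OF wL] bG])
    also have "\<dots> = pairing w ?G - pairing w ?G'"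
      by (simp only: pairing_shift[OF wL bG])
    also have "\<dots> = pairing w ?G + pairing w (\<lambda>z. - 1 * ?G' z)"
      by (simp only: pairing_scale_right) simp
    also have "\<dots> = pairing w (\<lambda>z. ?G z + - 1 * ?G' z)"
      by (rule pairing_add_right[OF wL bG bG', symmetric])
    finally have eq: "pairing f ?G - pairing h ?G = pairing w (\<lambda>z. ?G z + - 1 * ?G' z)" .
    have "bounded_fun (\<bar>\<theta>\<bar> * (2 * b)) (\<lambda>z. ?G z + - 1 * ?G' z)"
      unfolding bounded_fun_def
    proof (intro conjI ballI)
      show "(\<lambda>z. ?G z + - 1 * ?G' z) \<in> borel_measurable (Seq \<Otimes>\<^sub>M m)"
        using bounded_funD(1)[OF bounded_fun_add[OF bG bG']] .
      fix z assume z: "z \<in> space (Seq \<Otimes>\<^sub>M m)"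
      have "cmod (?G z + - 1 * ?G' z) \<le> \<bar>\<theta> * S n z - \<theta> * S n (shift z)\<bar>"
        using cmod_iexp_diff_le[of "\<theta> * S n z" "\<theta> * S n (shift z)"] by simp
      also have "\<dots> = \<bar>\<theta>\<bar> * \<bar>S n (shift z) - S n z\<bar>"
        by (simp add: right_diff_distrib[symmetric] abs_mult abs_minus_commute)
      also have "\<dots> \<le> \<bar>\<theta>\<bar> * (2 * b)" by (intro mult_left_mono S_shift_diff_bound[OF z]) simp
      finally show "cmod (?G z + - 1 * ?G' z) \<le> \<bar>\<theta>\<bar> * (2 * b)" .
    qed
    then show ?thesis unfolding eq by (rule pairing_bound[OF wL])
  qed
  have "(\<lambda>n. pairing f (E n (t / sqrt (real n))) - pairing h (E n (t / sqrt (real n)))) \<longlonglongrightarrow> 0"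
  proof (rule Lim_null_comparison[OF always_eventually[OF allI[OF diff]]])
    have "(\<lambda>n. t / sqrt (real n)) \<longlonglongrightarrow> 0"
      by (rule tendsto_divide_0[OF tendsto_const])
         (rule filterlim_at_top_imp_at_infinity[OF filterlim_compose[OF sqrt_at_top filterlim_real_sequentially]])
    then have "(\<lambda>n. \<bar>t / sqrt (real n)\<bar> * (2 * b) * L1_norm m w) \<longlonglongrightarrow> \<bar>0\<bar> * (2 * b) * L1_norm m w"
      by (intro tendsto_intros)
    then show "(\<lambda>n. \<bar>t / sqrt (real n)\<bar> * (2 * b) * L1_norm m w) \<longlonglongrightarrow> 0" by simp
  qed
  from tendsto_add[OF this characteristic_function_invariant[OF v gk s0, of t]] show ?thesis by simp
qed

end

section \<open>Convergence in law\<close>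

lemma real_distribution_normal_law:
  assumes "0 \<le> v"
  shows "real_distribution (normal_law a v)"
proof (cases "v = 0")
  case True
  then show ?thesis
    by (auto simp: normal_law_def real_distribution_def real_distribution_axioms_def
        intro!: prob_space_return)
next
  case False
  then show ?thesis using assms prob_space_normal_density[of "sqrt v" a]
    by (auto simp: normal_law_def real_distribution_def real_distribution_axioms_def)
qed

lemma char_normal_law:
  assumes v: "0 \<le> v"
  shows "char (normal_law 0 v) t = complex_of_real (exp (- (v * t^2 / 2)))"
proof (cases "v = 0")
  case True
  then show ?thesis by (simp add: normal_law_def char_def integral_return)
next
  case False
  let ?N = "std_normal_distribution"
  interpret N: real_distribution ?N by (rule real_dist_normal_dist)
  have pos: "0 < sqrt v" using False v by simp
  have "distributed ?N lborel (\<lambda>x. x) std_normal_density"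
    unfolding distributed_def by (auto simp: distr_id2)
  from N.normal_density_affine[OF this, of "sqrt v" 0] pos
  have dist: "distributed ?N lborel (\<lambda>x. sqrt v * x) (normal_density 0 (sqrt v))" by simp
  have "normal_law 0 v = distr ?N lborel (\<lambda>x. sqrt v * x)"
    using distributed_distr_eq_density[OF dist] False by (simp add: normal_law_def)
  then have "char (normal_law 0 v) t = char ?N (t * sqrt v)"
    unfolding char_def by (simp add: integral_distr mult.assoc)
  also have "\<dots> = complex_of_real (exp (- (v * t^2 / 2)))"
    using v by (simp add: char_std_normal_distribution power_mult_distrib mult.commute)
  finally show ?thesis .
qed

context annealed_clt
begin

text \<open>
  The Green--Kubo value is a priori complex; as a limit of normalised second moments it is real and
  nonnegative.
\<close>

lemma asymptotic_variance_eq_green_kubo: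
  assumes v: "corrector v"
    and h0: "\<And>x. x \<in> space m \<Longrightarrow> 0 \<le> h0 x" and h0m: "h0 \<in> borel_measurable m"
    and h: "h = (\<lambda>x. complex_of_real (h0 x))"
    and prob: "prob_space (density m (\<lambda>x. ennreal (h0 x)))"
  defines "s \<equiv> asymptotic_variance W T (density m (\<lambda>x. ennreal (h0 x))) \<phi>"
  shows "green_kubo v = complex_of_real s" "0 \<le> s"
proof -
  let ?\<mu> = "density m (\<lambda>x. ennreal (h0 x))"
  define r where "r n = (1 / real n) * (LINT z|annealed_measure W ?\<mu>. (S n z)\<^sup>2)" for n
  have r0: "0 \<le> r n" for n by (simp add: r_def)
  have "complex_of_real (r n)
      = complex_of_real (1 / real n) * pairing h (\<lambda>z. complex_of_real ((S n z)^2))" for n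
  proof -
    have "bounded_fun (real n * b * (real n * b)) (\<lambda>z. complex_of_real (S n z) * complex_of_real (S n z))"
      by (intro bounded_fun_mult bounded_fun_S)
    then have bd: "bounded_fun (real n * b * (real n * b)) (\<lambda>z. complex_of_real ((S n z)^2))"
      by (simp add: power2_eq_square)
    have "complex_of_real (LINT z|annealed_measure W ?\<mu>. (S n z)\<^sup>2)
        = (LINT z|annealed_measure W ?\<mu>. complex_of_real ((S n z)\<^sup>2))"
      by (rule integral_complex_of_real[symmetric])
    also have "\<dots> = pairing h (\<lambda>z. complex_of_real ((S n z)^2))"
      unfolding h using h_L1 h by (intro integral_annealed_measure[OF h0m h0 _ prob bd]) auto
    finally show ?thesis by (simp add: r_def)
  qed
  with second_moment_limit[OF v] have lim: "(\<lambda>n. complex_of_real (r n)) \<longlonglongrightarrow> green_kubo v" by simp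
  then have re: "r \<longlonglongrightarrow> Re (green_kubo v)" and im: "(\<lambda>n. 0) \<longlonglongrightarrow> Im (green_kubo v)"
    using tendsto_Re[OF lim] tendsto_Im[OF lim] by auto
  have s: "s = Re (green_kubo v)"
    unfolding s_def asymptotic_variance_def by (rule limI[OF re, unfolded r_def[abs_def]])
  have "Im (green_kubo v) = 0" using im by (simp add: LIMSEQ_const_iff)
  then show "green_kubo v = complex_of_real s" by (simp add: s complex_eq_iff)
  show "0 \<le> s" unfolding s using r0 by (intro LIMSEQ_le_const[OF re]) auto
qed

end

theorem theorem3p5:
  fixes W :: "'w measure" and m :: "'x measure" and T :: "'w \<Rightarrow> 'x \<Rightarrow> 'x"
    and P :: "('x \<Rightarrow> complex) \<Rightarrow> ('x \<Rightarrow> complex)"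
    and B :: "('x \<Rightarrow> complex) set" and nrm :: "('x \<Rightarrow> complex) \<Rightarrow> real"
    and B0 :: "('x \<Rightarrow> complex) set" and nrm0 :: "('x \<Rightarrow> complex) \<Rightarrow> real"
    and C :: real
    and \<phi> :: "'x \<Rightarrow> real"
    and \<mu> \<nu> :: "'x measure"
  assumes system: "random_system W m T"
    and P: "annealed_transfer_operator W m T P"
    and B: "banach_function_space m B nrm"
    and A1: "compactly_embedded_in_L1 m B nrm"
    and A2: "\<And>c. (\<lambda>_. c) \<in> B"
    and A3: "\<And>f. f \<in> B \<Longrightarrow> (\<lambda>x. complex_of_real (cmod (f x))) \<in> B"
            "\<And>f. f \<in> B \<Longrightarrow> (\<lambda>x. cnj (f x)) \<in> B"
    and A4: "\<And>f. f \<in> B \<Longrightarrow> P f \<in> B"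
            "\<exists>c. \<forall>f\<in>B. nrm (P f) \<le> c * nrm f"
    and A5: "\<exists>N::nat. N \<ge> 1 \<and> (\<exists>\<rho> K. \<rho> < 1 \<and> K \<ge> 0 \<and>
              (\<forall>f\<in>B. nrm ((P ^^ N) f) \<le> \<rho> * nrm f + K * L1_norm m f))"
    and A6: "simple_eigenvalue m B P 1"
            "isolated_in_spectrum m B nrm P 1"
            "\<And>l. eigenvalue m B P l \<Longrightarrow> cmod l = 1 \<Longrightarrow> l = 1"
    and B0: "banach_function_space m B0 nrm0"
    and C: "C > 0"
    and mult: "\<And>f g. f \<in> B0 \<Longrightarrow> g \<in> B \<Longrightarrow>
              (\<lambda>x. f x * g x) \<in> B \<and> nrm (\<lambda>x. f x * g x) \<le> C * nrm0 f * nrm g"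
    and \<mu>: "\<mu> \<in> prob_measures_with_density_in m B" "stationary W T \<mu>"
    and \<phi>: "(\<lambda>x. complex_of_real (\<phi> x)) \<in> B0" "bounded (\<phi> ` space m)"
            "(LINT x|\<mu>. \<phi> x) = 0"
    and \<nu>: "\<nu> \<in> prob_measures_with_density_in m B"
  shows "weak_conv_m
           (\<lambda>n. distr (annealed_measure W \<nu>) borel (\<lambda>z. birkhoff_sum T \<phi> n z / sqrt (real n)))
           (normal_law 0 (asymptotic_variance W T \<mu> \<phi>))"
proof -
  obtain h0 where h0 [measurable]: "h0 \<in> borel_measurable m" and h0_nn: "\<And>x. x \<in> space m \<Longrightarrow> 0 \<le> h0 x"
    and h0B: "(\<lambda>x. complex_of_real (h0 x)) \<in> B" and \<mu>_eq: "\<mu> = density m (\<lambda>x. ennreal (h0 x))"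
    and \<mu>_prob: "prob_space (density m (\<lambda>x. ennreal (h0 x)))"
    using \<mu>(1) unfolding prob_measures_with_density_in_def by blast
  obtain f0 where f0 [measurable]: "f0 \<in> borel_measurable m" and f0_nn: "\<And>x. x \<in> space m \<Longrightarrow> 0 \<le> f0 x"
    and f0B: "(\<lambda>x. complex_of_real (f0 x)) \<in> B" and \<nu>_eq: "\<nu> = density m (\<lambda>x. ennreal (f0 x))"
    and \<nu>_prob: "prob_space (density m (\<lambda>x. ennreal (f0 x)))"
    using \<nu> unfolding prob_measures_with_density_in_def by blast
  let ?h = "\<lambda>x. complex_of_real (h0 x)" and ?f = "\<lambda>x. complex_of_real (f0 x)"
  interpret annealed_operator_on_B W m T P B nrm
    by (intro annealed_operator_on_B.intro annealed_system.intro annealed_system_axioms.intro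
        annealed_operator_on_B_axioms.intro system P B A1 A4 A5 A6(1,2))
  have density_integral: "(LINT x|m. complex_of_real (g x)) = 1"
    if g [measurable]: "g \<in> borel_measurable m" and g0: "\<And>x. x \<in> space m \<Longrightarrow> 0 \<le> g x"
      and prob: "prob_space (density m (\<lambda>x. ennreal (g x)))" for g
  proof -
    interpret D: prob_space "density m (\<lambda>x. ennreal (g x))" by fact
    have "(1::real) = (LINT x|density m (\<lambda>x. ennreal (g x)). 1)" using D.prob_space by simp
    also have "\<dots> = (LINT x|m. g x)" using g0 by (subst integral_density) auto
    finally show ?thesis by simp
  qed
  obtain b where b: "\<And>x. x \<in> space m \<Longrightarrow> \<bar>\<phi> x\<bar> \<le> b"
    using \<phi>(2) unfolding bounded_iff by auto
  have \<phi>c: "(\<lambda>x. complex_of_real (\<phi> x)) \<in> borel_measurable m"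
    using \<phi>(1) banach_function_space.subset_L1[OF B0] by (auto simp: L1_def)
  have \<phi>m [measurable]: "\<phi> \<in> borel_measurable m"
    using measurable_compose[OF \<phi>c borel_measurable_Re] by simp
  have mean: "(LINT x|m. complex_of_real (\<phi> x) * ?h x) = 0"
  proof -
    have "0 = (LINT x|m. h0 x * \<phi> x)"
      using \<phi>(3) h0_nn unfolding \<mu>_eq by (subst (asm) integral_density) auto
    then have "complex_of_real (LINT x|m. h0 x * \<phi> x) = 0" by simp
    then show ?thesis unfolding integral_complex_of_real[symmetric] by (simp add: mult.commute)
  qed
  interpret annealed_clt W m T P B nrm ?h \<phi> b
  proof unfold_locales
    show "?h \<in> B" by fact
    show "AE x in m. P ?h x = ?h x"
      using P_stationary_density[OF h0 h0_nn L1_mem[OF h0B] \<mu>_prob] \<mu>(2) unfolding \<mu>_eq by simp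
    show "(LINT x|m. ?h x) = 1" by (rule density_integral[OF h0 h0_nn \<mu>_prob])
    show "(LINT x|m. complex_of_real (\<phi> x) * ?h x) = 0" by (rule mean)
    show "(\<lambda>x. complex_of_real (\<phi> x) * f x) \<in> B" if "f \<in> B" for f
      using mult[OF \<phi>(1) that] by simp
  qed (use \<phi>m b in auto)
  obtain v where v: "corrector v" by (rule corrector_exists)
  define s where "s = asymptotic_variance W T \<mu> \<phi>"
  have gk: "green_kubo v = complex_of_real s" and s0: "0 \<le> s"
    using asymptotic_variance_eq_green_kubo[OF v h0_nn h0 refl \<mu>_prob] unfolding s_def \<mu>_eq by auto
  let ?M = "annealed_measure W \<nu>"
  interpret N: prob_space "density m (\<lambda>x. ennreal (f0 x))" by fact
  interpret SN: pair_prob_space Seq "density m (\<lambda>x. ennreal (f0 x))" ..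
  have M_prob: "prob_space ?M"
    unfolding annealed_measure_def \<nu>_eq by (rule SN.prob_space_axioms)
  have sets_M: "sets ?M = sets (Seq \<Otimes>\<^sub>M m)"
    unfolding annealed_measure_def \<nu>_eq by (intro sets_pair_measure_cong) auto
  have SM: "(\<lambda>z. S n z / sqrt (real n)) \<in> borel_measurable ?M" for n
    unfolding measurable_cong_sets[OF sets_M refl] by measurable
  let ?D = "\<lambda>n. distr ?M borel (\<lambda>z. S n z / sqrt (real n))"
  have "weak_conv_m ?D (normal_law 0 s)"
  proof (rule levy_continuity)
    show "real_distribution (?D n)" for n
      using prob_space.prob_space_distr[OF M_prob SM]
      by (auto simp: real_distribution_def real_distribution_axioms_def)
    show "real_distribution (normal_law 0 s)" by (rule real_distribution_normal_law[OF s0])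
    fix t
    have "char (?D n) t = pairing ?f (E n (t / sqrt (real n)))" for n
    proof -
      have "char (?D n) t = (LINT z|?M. E n (t / sqrt (real n)) z)"
        unfolding char_def by (subst integral_distr[OF SM]) simp_all
      also have "\<dots> = pairing ?f (E n (t / sqrt (real n)))"
        unfolding \<nu>_eq
        by (rule integral_annealed_measure[OF f0 f0_nn L1_mem[OF f0B] \<nu>_prob bounded_fun_E])
      finally show ?thesis .
    qed
    then show "(\<lambda>n. char (?D n) t) \<longlonglongrightarrow> char (normal_law 0 s) t"
      using characteristic_function_limit[OF v gk s0 f0B density_integral[OF f0 f0_nn \<nu>_prob]]
      by (simp add: char_normal_law[OF s0])
  qed
  then show ?thesis by (simp add: s_def)
qed

end
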